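(* Let $\Omega\subset\mathbb{R}^N$ ($N\ge 2$) be a bounded domain, let $1<p\le q<\infty$, let $a:\Omega\to[0,\infty)$ be a $C^1$ function, and let $u:\Omega\to\mathbb{R}$ be continuous. Define the constants $\alpha_p,\beta_p,\alpha_q,\beta_q$ by $$\alpha_p+\beta_p=1,\quad \frac{\alpha_p}{\beta_p}=\frac{p-2}{N+2},\qquad \alpha_q+\beta_q=1,\quad \frac{\alpha_q}{\beta_q}=\frac{q-2}{N+2},$$ and, for a function $w$ differentiable at $x$, put $M_w(x)=a(x)\frac{N+q}{N+p}|\nabla w(x)|^{q-p}$. Then $u$ is a viscosity solution (in the sense given in the context) of $$-\operatorname{div}\left(|\nabla u|^{p-2}\nabla u+a(x)|\nabla u|^{q-2}\nabla u\right)=0\quad\text{in }\Omega$$ if and only if the asymptotic expansion $$\begin{aligned}u(x)={}&\frac{\alpha_p+M_u(x)\alpha_q}{2(1+M_u(x))}\left\{\max_{\overline{B_\varepsilon(x)}}u+\min_{\overline{B_\varepsilon(x)}}u\right\}+\frac{\beta_p+M_u(x)\beta_q}{1+M_u(x)}\,\frac{1}{|B_\varepsilon(x)|}\int_{B_\varepsilon(x)}u(y)\,dy\\&+\frac{\varepsilon|\nabla u(x)|^{q-p}}{4(N+p)(1+M_u(x))}\,\frac{1}{|B_\varepsilon(x)|}\int_{B_\varepsilon(x)}\big(u(y+\varepsilon\nabla a(x))-u(y-\varepsilon\nabla a(x))\big)\,dy+o(\varepsilon^2)\end{aligned}$$ as $\varepsilon\to0$ holds for all $x\in\Omega$ in the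 viscosity sense (as defined in the context).
   Context: $B_\varepsilon(x)$ is the open ball of radius $\varepsilon$ centred at $x$, and $|B_\varepsilon(x)|$ its Lebesgue measure. When $\nabla\phi(x)\ne0$, write $\Delta_\infty\phi(x)=|\nabla\phi(x)|^{-2}\langle D^2\phi(x)\nabla\phi(x),\nabla\phi(x)\rangle$ (normalized infinity Laplacian). **Viscosity solution.** A lower semicontinuous $u$ is a viscosity supersolution if for every $x\in\Omega$ and every $C^2$ function $\phi$ such that $u-\phi$ has a strict minimum at $x$ and $\nabla\phi(x)\neq0$, one has $$-\big((p-2)\Delta_\infty\phi(x)+\Delta\phi(x)\big)-a(x)|\nabla\phi(x)|^{q-p}\big((q-2)\Delta_\infty\phi(x)+\Delta\phi(x)\big)-|\nabla\phi(x)|^{q-p}\langle\nabla a(x),\nabla\phi(x)\rangle\ge0.$$ An upper semicontinuous $u$ is a viscosity subsolution if for every $x\in\Omega$ and every $C^2$ function $\phi$ such that $u-\phi$ has a strict maximum at $x$ and $\nabla\phi(x)\ne0$, the same expression is $\le0$. A viscosity solution is a function that is both a viscosity supersolution and a viscosity subsolution. **Asymptotic expansion in the viscosity sense.** For a $C^2$ function $\phi$ with $\nabla\phi(x)\ne 0$ and small $\varepsilon>0$, let $$\begin{aligned}E_\varepsilon[\phi](x)={}&-\phi(x)+\frac{\alpha_p+M_\phi(x)\alpha_q}{2(1+M_\phi(x))}\left\{\max_{\overline{B_\varepsilon(x)}}\phi+\min_{\overline{B_\varepsilon(x)}}\phi\right\}+\frac{\beta_p+M_\phi(x)\beta_q}{1+M_\phi(x)}\,\frac{1}{|B_\varepsilon(x)|}\int_{B_\varepsilon(x)}\phi(y)\,dy\\&+\frac{\varepsilon|\nabla\phi(x)|^{q-p}}{4(N+p)(1+M_\phi(x))}\,\frac{1}{|B_\varepsilon(x)|}\int_{B_\varepsilon(x)}\big(\phi(y+\varepsilon\nabla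 a(x))-\phi(y-\varepsilon\nabla a(x))\big)\,dy.\end{aligned}$$ The expansion holds at $x$ in the viscosity sense if: (i) for every $C^2$ function $\phi$ such that $u-\phi$ has a strict minimum at $x$ with $u(x)=\phi(x)$ and $\nabla\phi(x)\neq0$, one has $0\ge E_\varepsilon[\phi](x)+o(\varepsilon^2)$ as $\varepsilon\to0$; and (ii) for every $C^2$ function $\phi$ such that $u-\phi$ has a strict maximum at $x$ with $u(x)=\phi(x)$ and $\nabla\phi(x)\neq0$, one has $0\le E_\varepsilon[\phi](x)+o(\varepsilon^2)$ as $\varepsilon\to0$. Here $0\ge E_\varepsilon+o(\varepsilon^2)$ means that there is $r(\varepsilon)$ with $r(\varepsilon)/\varepsilon^2\to0$ as $\varepsilon\to0^+$ and $E_\varepsilon+r(\varepsilon)\le0$ for all sufficiently small $\varepsilon>0$; similarly for $\le$. No derivative of $u$ itself is required to exist. *)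

theory Defs
  imports "HOL-Analysis.Analysis"
begin

definition gradient :: "(real^'n \<Rightarrow> real) \<Rightarrow> real^'n \<Rightarrow> real^'n" where
  "gradient f x = (THE D. GDERIV f x :> D)"

definition hessian :: "(real^'n \<Rightarrow> real) \<Rightarrow> real^'n \<Rightarrow> real^'n^'n" where
  "hessian f x = jacobian (gradient f) (at x)"

(* Both smoothness classes are meant for open S only: derivatives are taken at x, not within S. *)

definition C1_fun_on :: "(real^'n) set \<Rightarrow> (real^'n \<Rightarrow> real) \<Rightarrow> bool" where
  "C1_fun_on S f \<longleftrightarrow> (\<forall>x\<in>S. f differentiable (at x)) \<and> continuous_on S (gradient f)"

definition C2_fun_on :: "(real^'n) set \<Rightarrow> (real^'n \<Rightarrow> real) \<Rightarrow> bool" where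
  "C2_fun_on S f \<longleftrightarrow> C1_fun_on S f \<and> (\<forall>x\<in>S. gradient f differentiable (at x))
     \<and> continuous_on S (hessian f)"

definition laplacian :: "(real^'n \<Rightarrow> real) \<Rightarrow> real^'n \<Rightarrow> real" where
  "laplacian f x = trace (hessian f x)"

(* normalized infinity Laplacian; only meaningful where the gradient does not vanish *)
definition inf_laplacian :: "(real^'n \<Rightarrow> real) \<Rightarrow> real^'n \<Rightarrow> real" where
  "inf_laplacian f x =
     ((hessian f x *v gradient f x) \<bullet> gradient f x) / (norm (gradient f x))\<^sup>2"

definition lsc_on :: "(real^'n) set \<Rightarrow> (real^'n \<Rightarrow> real) \<Rightarrow> bool" where
  "lsc_on S f \<longleftrightarrow> (\<forall>x\<in>S. \<forall>c<f x. eventually (\<lambda>y. c < f y) (at x within S))"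

definition usc_on :: "(real^'n) set \<Rightarrow> (real^'n \<Rightarrow> real) \<Rightarrow> bool" where
  "usc_on S f \<longleftrightarrow> (\<forall>x\<in>S. \<forall>c>f x. eventually (\<lambda>y. f y < c) (at x within S))"

definition strict_min_at :: "(real^'n) set \<Rightarrow> (real^'n \<Rightarrow> real) \<Rightarrow> real^'n \<Rightarrow> bool" where
  "strict_min_at S f x \<longleftrightarrow> x \<in> S \<and> (\<forall>y\<in>S. y \<noteq> x \<longrightarrow> f x < f y)"

definition strict_max_at :: "(real^'n) set \<Rightarrow> (real^'n \<Rightarrow> real) \<Rightarrow> real^'n \<Rightarrow> bool" where
  "strict_max_at S f x \<longleftrightarrow> x \<in> S \<and> (\<forall>y\<in>S. y \<noteq> x \<longrightarrow> f y < f x)"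

(* -div(|Df|^(p-2) Df + a |Df|^(q-2) Df) expanded in nondivergence form and divided by
   |Df|^(p-2); only used where Df(x) is nonzero *)
definition double_phase_op ::
  "real \<Rightarrow> real \<Rightarrow> (real^'n \<Rightarrow> real) \<Rightarrow> (real^'n \<Rightarrow> real) \<Rightarrow> real^'n \<Rightarrow> real" where
  "double_phase_op p q a f x =
     - ((p - 2) * inf_laplacian f x + laplacian f x)
     - a x * norm (gradient f x) powr (q - p) * ((q - 2) * inf_laplacian f x + laplacian f x)
     - norm (gradient f x) powr (q - p) * (gradient a x \<bullet> gradient f x)"

definition viscosity_supersolution ::
  "(real^'n) set \<Rightarrow> real \<Rightarrow> real \<Rightarrow> (real^'n \<Rightarrow> real) \<Rightarrow> (real^'n \<Rightarrow> real) \<Rightarrow> bool" where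
  "viscosity_supersolution \<Omega> p q a u \<longleftrightarrow> lsc_on \<Omega> u \<and>
     (\<forall>x\<in>\<Omega>. \<forall>\<phi>. C2_fun_on \<Omega> \<phi> \<and> strict_min_at \<Omega> (\<lambda>y. u y - \<phi> y) x \<and> gradient \<phi> x \<noteq> 0
        \<longrightarrow> double_phase_op p q a \<phi> x \<ge> 0)"

definition viscosity_subsolution ::
  "(real^'n) set \<Rightarrow> real \<Rightarrow> real \<Rightarrow> (real^'n \<Rightarrow> real) \<Rightarrow> (real^'n \<Rightarrow> real) \<Rightarrow> bool" where
  "viscosity_subsolution \<Omega> p q a u \<longleftrightarrow> usc_on \<Omega> u \<and>
     (\<forall>x\<in>\<Omega>. \<forall>\<phi>. C2_fun_on \<Omega> \<phi> \<and> strict_max_at \<Omega> (\<lambda>y. u y - \<phi> y) x \<and> gradient \<phi> x \<noteq> 0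
        \<longrightarrow> double_phase_op p q a \<phi> x \<le> 0)"

definition viscosity_solution ::
  "(real^'n) set \<Rightarrow> real \<Rightarrow> real \<Rightarrow> (real^'n \<Rightarrow> real) \<Rightarrow> (real^'n \<Rightarrow> real) \<Rightarrow> bool" where
  "viscosity_solution \<Omega> p q a u \<longleftrightarrow>
     viscosity_supersolution \<Omega> p q a u \<and> viscosity_subsolution \<Omega> p q a u"

definition ball_average :: "(real^'n \<Rightarrow> real) \<Rightarrow> real^'n \<Rightarrow> real \<Rightarrow> real" where
  "ball_average f x \<epsilon> = (1 / measure lebesgue (ball x \<epsilon>)) * (LINT y:ball x \<epsilon>|lebesgue. f y)"

definition M_coeff ::
  "real \<Rightarrow> real \<Rightarrow> (real^'n \<Rightarrow> real) \<Rightarrow> (real^'n \<Rightarrow> real) \<Rightarrow> real^'n \<Rightarrow> real" where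
  "M_coeff p q a f x =
     a x * ((real CARD('n) + q) / (real CARD('n) + p)) * norm (gradient f x) powr (q - p)"

(* Sup and Inf over the closed ball are a maximum and a minimum as soon as f is continuous on it,
   which holds for small \<epsilon> when f is continuous near x. *)
definition expansion_error ::
  "real \<Rightarrow> real \<Rightarrow> real \<Rightarrow> real \<Rightarrow> real \<Rightarrow> real \<Rightarrow> (real^'n \<Rightarrow> real)
     \<Rightarrow> (real^'n \<Rightarrow> real) \<Rightarrow> real^'n \<Rightarrow> real \<Rightarrow> real" where
  "expansion_error p q \<alpha>p \<beta>p \<alpha>q \<beta>q a \<phi> x \<epsilon> =
     - \<phi> x
     + (\<alpha>p + M_coeff p q a \<phi> x * \<alpha>q) / (2 * (1 + M_coeff p q a \<phi> x))
         * ((SUP y\<in>cball x \<epsilon>. \<phi> y) + (INF y\<in>cball x \<epsilon>. \<phi> y))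
     + (\<beta>p + M_coeff p q a \<phi> x * \<beta>q) / (1 + M_coeff p q a \<phi> x) * ball_average \<phi> x \<epsilon>
     + \<epsilon> * norm (gradient \<phi> x) powr (q - p)
           / (4 * (real CARD('n) + p) * (1 + M_coeff p q a \<phi> x))
         * ball_average (\<lambda>y. \<phi> (y + \<epsilon> *\<^sub>R gradient a x) - \<phi> (y - \<epsilon> *\<^sub>R gradient a x)) x \<epsilon>"

definition viscosity_expansion_at ::
  "(real^'n) set \<Rightarrow> real \<Rightarrow> real \<Rightarrow> real \<Rightarrow> real \<Rightarrow> real \<Rightarrow> real \<Rightarrow> (real^'n \<Rightarrow> real)
     \<Rightarrow> (real^'n \<Rightarrow> real) \<Rightarrow> real^'n \<Rightarrow> bool" where
  "viscosity_expansion_at \<Omega> p q \<alpha>p \<beta>p \<alpha>q \<beta>q a u x \<longleftrightarrow>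
     (\<forall>\<phi>. C2_fun_on \<Omega> \<phi> \<and> strict_min_at \<Omega> (\<lambda>y. u y - \<phi> y) x \<and> u x = \<phi> x \<and> gradient \<phi> x \<noteq> 0
        \<longrightarrow> (\<exists>r. ((\<lambda>\<epsilon>. r \<epsilon> / \<epsilon>\<^sup>2) \<longlongrightarrow> 0) (at_right 0) \<and>
              (\<forall>\<^sub>F \<epsilon> in at_right 0. expansion_error p q \<alpha>p \<beta>p \<alpha>q \<beta>q a \<phi> x \<epsilon> + r \<epsilon> \<le> 0))) \<and>
     (\<forall>\<phi>. C2_fun_on \<Omega> \<phi> \<and> strict_max_at \<Omega> (\<lambda>y. u y - \<phi> y) x \<and> u x = \<phi> x \<and> gradient \<phi> x \<noteq> 0
        \<longrightarrow> (\<exists>r. ((\<lambda>\<epsilon>. r \<epsilon> / \<epsilon>\<^sup>2) \<longlongrightarrow> 0) (at_right 0) \<and>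
              (\<forall>\<^sub>F \<epsilon> in at_right 0. expansion_error p q \<alpha>p \<beta>p \<alpha>q \<beta>q a \<phi> x \<epsilon> + r \<epsilon> \<ge> 0)))"

end

theory Submission
  imports Defs
begin

text \<open>
  The theorem is a computation for the test function alone; the candidate solution \<open>u\<close> enters
  only by selecting which test functions are admissible. Let \<open>\<phi>\<close> be a \<open>C\<^sup>2\<close> function with gradient
  \<open>g \<noteq> 0\<close> and Hessian \<open>H\<close> at \<open>x\<close>, let \<open>N\<close> be the dimension, and put
  \<open>M = a(x) (N + q) / (N + p) |g|\<^bsup>q-p\<^esup>\<close>. As \<open>\<epsilon> \<rightarrow> 0\<close>,

  \<^item> the maximum over the closed ball is \<open>\<phi>(x) + \<epsilon> |g| + \<epsilon>\<^sup>2/2 \<Delta>\<^sub>\<infinity>\<phi>(x) + o(\<epsilon>\<^sup>2)\<close> and the minimum is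
    \<open>\<phi>(x) - \<epsilon> |g| + \<epsilon>\<^sup>2/2 \<Delta>\<^sub>\<infinity>\<phi>(x) + o(\<epsilon>\<^sup>2)\<close>, so that the first order terms cancel in their sum
    (\<open>SUP_cball_expansion\<close>, \<open>INF_cball_expansion\<close>);
  \<^item> the mean over the ball is \<open>\<phi>(x) + \<epsilon>\<^sup>2 \<Delta>\<phi>(x) / (2 (N + 2)) + o(\<epsilon>\<^sup>2)\<close>
    (\<open>ball_average_expansion\<close>);
  \<^item> the mean of the symmetric difference is \<open>2 \<epsilon> \<langle>\<nabla>a(x), g\<rangle> + o(\<epsilon>)\<close>
    (\<open>ball_average_symmetric_difference\<close>).

  The constants are those for which the weighted sum of these expansions is the equation itself:
  the error in the expansion equals \<open>- \<epsilon>\<^sup>2 P / (2 (N + p) (1 + M)) + o(\<epsilon>\<^sup>2)\<close>, where \<open>P\<close> is the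
  value of the nondivergence operator at \<open>\<phi>\<close> and \<open>x\<close> (\<open>expansion_error_limit\<close>). As the factor
  \<open>2 (N + p) (1 + M)\<close> is positive, a one-sided inequality for the error up to \<open>o(\<epsilon>\<^sup>2)\<close> is the same as
  the reverse inequality for \<open>P\<close> (\<open>o_square_sign_le\<close>, \<open>o_square_sign_ge\<close>). The two definitions
  also differ in that the expansion is tested with functions touching \<open>u\<close> at \<open>x\<close>; adding a constant to
  \<open>\<phi>\<close> achieves this and leaves \<open>P\<close> unchanged.
\<close>

section \<open>Means over balls\<close>

lemma ball_content_pos: "0 < e \<Longrightarrow> 0 < measure lebesgue (ball (x::real^'n) e)"
  using content_ball_pos[of e x] by simp

lemma set_integrable_ball:
  fixes f :: "real^'n \<Rightarrow> real"
  assumes "continuous_on (cball x e) f"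
  shows "set_integrable lebesgue (ball x e) f"
proof -
  have "set_integrable lborel (cball x e) f"
    unfolding set_integrable_def using assms by (intro borel_integrable_compact) auto
  then have "set_integrable lborel (ball x e) f"
    by (rule set_integrable_subset) auto
  then show ?thesis
    by (simp add: set_integrable_def integrable_completion)
qed

lemma ball_average_eq_lborel:
  fixes f :: "real^'n \<Rightarrow> real"
  assumes "continuous_on (cball x e) f"
  shows "ball_average f x e = (\<integral>y. indicator (ball x e) y * f y \<partial>lborel) / measure lebesgue (ball x e)"
    and "(\<lambda>y. indicator (ball x e) y * f y) \<in> borel_measurable borel"
proof -
  have "continuous_on (ball x e) f"
    using assms continuous_on_subset ball_subset_cball by blast
  then show m: "(\<lambda>y. indicator (ball x e) y * f y) \<in> borel_measurable borel"
    using borel_measurable_continuous_on_indicator[of "ball x e" f] by simp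
  then show "ball_average f x e = (\<integral>y. indicator (ball x e) y * f y \<partial>lborel) / measure lebesgue (ball x e)"
    by (simp add: ball_average_def set_lebesgue_integral_def integral_completion)
qed

lemma ball_average_add:
  assumes "continuous_on (cball x e) f" "continuous_on (cball x e) g"
  shows "ball_average (\<lambda>y. f y + g y) x e = ball_average f x e + ball_average g x e"
  using assms
  by (simp add: ball_average_def set_integral_add set_integrable_ball distrib_left add_divide_distrib)

lemma ball_average_cmult: "ball_average (\<lambda>y. c * f y) x e = c * ball_average f x e"
  by (simp add: ball_average_def)

lemma ball_average_const:
  assumes "0 < e"
  shows "ball_average (\<lambda>y. c) (x::real^'n) e = c"
proof -
  have "(LINT y:ball x e|lebesgue. c) = c * measure lebesgue (ball x e)"
    using emeasure_lborel_ball_finite[of x e] by (simp add: set_lebesgue_integral_def)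
  then show ?thesis
    using ball_content_pos[OF assms, of x] by (simp add: ball_average_def)
qed

lemma ball_average_sum:
  assumes "finite I" "\<And>i. i \<in> I \<Longrightarrow> continuous_on (cball x e) (f i)"
  shows "ball_average (\<lambda>y. \<Sum>i\<in>I. f i y) x e = (\<Sum>i\<in>I. ball_average (f i) x e)"
  using assms
proof (induction I rule: finite_induct)
  case empty
  show ?case by (simp add: ball_average_def)
next
  case (insert i I)
  have "continuous_on (cball x e) (\<lambda>y. \<Sum>i\<in>I. f i y)"
    using insert.prems by (intro continuous_intros) auto
  then show ?case
    using insert by (simp add: ball_average_add)
qed

lemma ball_average_mono:
  fixes f g :: "real^'n \<Rightarrow> real"
  assumes "0 < e" "continuous_on (cball x e) f" "continuous_on (cball x e) g"
    and "\<And>y. y \<in> ball x e \<Longrightarrow> f y \<le> g y"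
  shows "ball_average f x e \<le> ball_average g x e"
proof -
  have "(LINT y:ball x e|lebesgue. f y) \<le> (LINT y:ball x e|lebesgue. g y)"
    using assms by (intro set_integral_mono set_integrable_ball) auto
  then show ?thesis
    unfolding ball_average_def by (intro mult_left_mono) auto
qed

lemma ball_average_close:
  fixes f g :: "real^'n \<Rightarrow> real"
  assumes "0 < e" "continuous_on (cball x e) f" "continuous_on (cball x e) g"
    and "\<And>y. y \<in> ball x e \<Longrightarrow> \<bar>f y - g y\<bar> \<le> d"
  shows "\<bar>ball_average f x e - ball_average g x e\<bar> \<le> d"
proof -
  have "ball_average f x e \<le> ball_average (\<lambda>y. g y + d) x e"
    using assms by (intro ball_average_mono continuous_intros) (auto simp: abs_le_iff algebra_simps)
  moreover have "ball_average g x e \<le> ball_average (\<lambda>y. f y + d) x e"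
    using assms(1-3) assms(4) by (intro ball_average_mono continuous_intros) (auto simp: abs_le_iff algebra_simps)
  ultimately show ?thesis
    using assms by (simp add: ball_average_add ball_average_const)
qed

text \<open>Substitution \<open>y = x + e h\<close>. All expansions are carried out on the fixed unit ball, where the
  radius appears only in the integrand.\<close>

lemma ball_average_rescale:
  fixes f :: "real^'n \<Rightarrow> real"
  assumes e: "0 < e" and f: "continuous_on (cball x e) f"
  shows "ball_average f x e = ball_average (\<lambda>h. f (x + e *\<^sub>R h)) 0 1"
proof -
  define F where "F = (\<lambda>y. indicator (ball x e) y * f y)"
  have F: "F \<in> borel_measurable borel"
    unfolding F_def by (rule ball_average_eq_lborel(2)[OF f])
  have f': "continuous_on (cball 0 1) (\<lambda>h. f (x + e *\<^sub>R h))"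
  proof (rule continuous_on_compose2[OF f])
    show "(\<lambda>h. x + e *\<^sub>R h) ` cball 0 1 \<subseteq> cball x e"
      using e by (auto simp: dist_norm mult_le_cancel_left1)
  qed (intro continuous_intros)
  have ind: "F (x + e *\<^sub>R h) = indicator (ball 0 1) h * f (x + e *\<^sub>R h)" for h
    using e by (auto simp: F_def indicator_def dist_norm)
  have "(\<integral>y. F y \<partial>lborel) =
      (\<integral>y. F y \<partial>density (distr lborel borel (\<lambda>h. x + e *\<^sub>R h)) (\<lambda>_. \<bar>e\<bar> ^ DIM(real^'n)))"
    using e lborel_affine[of e x] by simp
  also have "\<dots> = e ^ CARD('n) * (\<integral>h. F (x + e *\<^sub>R h) \<partial>lborel)"
  proof -
    have "(\<lambda>h. x + e *\<^sub>R h) \<in> borel_measurable borel"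
      by (intro borel_measurable_continuous_onI continuous_intros)
    then show ?thesis
      using e F by (subst integral_density) (simp_all add: integral_distr)
  qed
  finally have "(\<integral>y. F y \<partial>lborel) = e ^ CARD('n) * (\<integral>h. indicator (ball 0 1) h * f (x + e *\<^sub>R h) \<partial>lborel)"
    by (simp add: ind)
  moreover have "measure lebesgue (ball x e) = e ^ CARD('n) * measure lebesgue (ball (0::real^'n) 1)"
    using content_ball_conv_unit_ball[of e x] e by simp
  ultimately show ?thesis
    using e ball_average_eq_lborel(1)[OF f] ball_average_eq_lborel(1)[OF f']
    by (simp add: F_def)
qed

text \<open>The hypotheses say that \<open>T\<close> preserves Lebesgue measure and the ball. They are satisfied by the
  reflections and transpositions of coordinates, and these two kinds of symmetry determine the
  second moments of the ball up to one scalar.\<close>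

lemma ball_average_isometry:
  fixes f :: "real^'n \<Rightarrow> real"
  assumes f: "continuous_on (cball 0 e) f"
    and T: "continuous_on UNIV (T :: real^'n \<Rightarrow> real^'n)" "distr lborel borel T = lborel" "\<And>h. norm (T h) = norm h"
  shows "ball_average (\<lambda>h. f (T h)) 0 e = ball_average f 0 e"
proof -
  define F where "F = (\<lambda>y. indicator (ball 0 e) y * f y)"
  have F: "F \<in> borel_measurable borel"
    unfolding F_def by (rule ball_average_eq_lborel(2)[OF f])
  have f': "continuous_on (cball 0 e) (\<lambda>h. f (T h))"
    by (rule continuous_on_compose2[OF f continuous_on_subset[OF T(1)]]) (auto simp: T(3))
  have "(\<integral>y. F y \<partial>lborel) = (\<integral>y. F y \<partial>distr lborel borel T)"
    by (simp add: T(2))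
  also have "\<dots> = (\<integral>h. F (T h) \<partial>lborel)"
    using F T(1) by (intro integral_distr) (auto intro: borel_measurable_continuous_onI)
  also have "\<dots> = (\<integral>h. indicator (ball 0 e) h * f (T h) \<partial>lborel)"
    by (simp add: F_def indicator_def T(3))
  finally show ?thesis
    by (simp add: ball_average_eq_lborel(1)[OF f] ball_average_eq_lborel(1)[OF f'] F_def)
qed

lemma lborel_distr_flip_coordinate:
  fixes i :: "'n::finite"
  shows "distr lborel borel (\<lambda>h. \<chi> k. if k = i then - h $ k else h $ k) = (lborel :: (real^'n) measure)"
proof -
  define c where "c = (\<lambda>j::real^'n. if j = axis i 1 then - 1 else 1 :: real)"
  have T: "(\<chi> k. if k = i then - h $ k else h $ k) = 0 + (\<Sum>j\<in>Basis. (c j * (h \<bullet> j)) *\<^sub>R j)" for h :: "real^'n"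
  proof -
    have "(\<chi> k. if k = i then - h $ k else h $ k) \<bullet> b = c b * (h \<bullet> b)" if b: "b \<in> Basis" for b
    proof -
      obtain k where "b = axis k 1"
        using b by (auto simp: Basis_vec_def)
      then show ?thesis
        by (simp add: c_def inner_axis axis_eq_axis)
    qed
    then show ?thesis
      by (subst euclidean_eq_iff) simp
  qed
  have "(\<Prod>j\<in>Basis. \<bar>c j\<bar>) = 1"
    by (intro prod.neutral) (auto simp: c_def)
  then have "lborel = density (distr lborel borel (\<lambda>h. 0 + (\<Sum>j\<in>Basis. (c j * (h \<bullet> j)) *\<^sub>R j))) (\<lambda>_. 1)"
    using lborel_affine_euclidean[of c 0] by (simp add: c_def)
  then show ?thesis
    unfolding T density_1 by simp
qed

text \<open>Lebesgue measure is determined by its values on boxes, and a transposition of coordinates only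
  permutes the side lengths of a box.\<close>

lemma lborel_distr_swap_coordinates:
  fixes i j :: "'n::finite"
  shows "distr lborel borel (\<lambda>h. \<chi> k. h $ Transposition.transpose i j k) = (lborel :: (real^'n) measure)"
proof (rule sym, rule lborel_eqI)
  let ?t = "Transposition.transpose i j"
  let ?T = "\<lambda>h::real^'n. \<chi> k. h $ ?t k"
  fix l u :: "real^'n"
  assume le: "\<And>b. b \<in> Basis \<Longrightarrow> l \<bullet> b \<le> u \<bullet> b"
  have le': "l $ k \<le> u $ k" for k
    using le[of "axis k 1"] by (simp add: inner_axis)
  have bij: "bij ?t" by simp
  have prod_vec: "(\<Prod>b\<in>Basis. (w::real^'n) \<bullet> b) = (\<Prod>k\<in>UNIV. w $ k)" for w
  proof -
    have "Basis = (\<lambda>k::'n. axis k (1::real)) ` UNIV"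
      by (auto simp: Basis_vec_def)
    moreover have "inj (\<lambda>k::'n. axis k (1::real))"
      by (auto simp: inj_def axis_eq_axis)
    ultimately have "(\<Prod>b\<in>Basis. w \<bullet> b) = (\<Prod>k\<in>UNIV. w \<bullet> axis k 1)"
      using prod.reindex[of "\<lambda>k::'n. axis k (1::real)" UNIV "\<lambda>b. w \<bullet> b"] by (simp only: o_def)
    then show ?thesis
      by (simp add: inner_axis)
  qed
  have "h \<in> ?T -` box l u \<longleftrightarrow> h \<in> box (?T l) (?T u)" for h
  proof -
    have "h \<in> ?T -` box l u \<longleftrightarrow> (\<forall>k. l $ k < h $ ?t k \<and> h $ ?t k < u $ k)"
      by (simp add: mem_box_cart)
    also have "\<dots> \<longleftrightarrow> (\<forall>k. l $ ?t k < h $ k \<and> h $ k < u $ ?t k)"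
      by (simp only: all_conj_distrib) (metis transpose_involutory)
    finally show ?thesis
      by (simp add: mem_box_cart)
  qed
  then have eq: "?T -` box l u = box (?T l) (?T u)"
    by blast
  have meas: "?T \<in> borel_measurable borel"
    by (intro borel_measurable_continuous_onI continuous_intros)
  have leT: "b \<in> Basis \<Longrightarrow> ?T l \<bullet> b \<le> ?T u \<bullet> b" for b
    using le' by (auto simp: Basis_vec_def inner_axis)
  have "emeasure (distr lborel borel ?T) (box l u) = emeasure lborel (box (?T l) (?T u))"
    using meas by (simp add: emeasure_distr eq)
  also have "\<dots> = (\<Prod>b\<in>Basis. (?T u - ?T l) \<bullet> b)"
    using leT by (simp add: emeasure_lborel_box_eq inner_diff_left)
  also have "\<dots> = (\<Prod>k\<in>UNIV. (\<lambda>k. u $ k - l $ k) (?t k))"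
    unfolding prod_vec by simp
  also have "\<dots> = (\<Prod>k\<in>UNIV. u $ k - l $ k)"
    by (subst prod.reindex_bij_betw[OF bij]) simp
  also have "\<dots> = (\<Prod>b\<in>Basis. (u - l) \<bullet> b)"
    unfolding prod_vec by simp
  finally show "emeasure (distr lborel borel ?T) (box l u) = (\<Prod>b\<in>Basis. (u - l) \<bullet> b)" .
qed simp

lemma ball_average_flip_coordinate:
  fixes f :: "real^'n \<Rightarrow> real"
  assumes "continuous_on (cball 0 e) f"
  shows "ball_average (\<lambda>h. f (\<chi> k. if k = i then - h $ k else h $ k)) 0 e = ball_average f 0 e"
proof (rule ball_average_isometry[OF assms _ lborel_distr_flip_coordinate])
  show "continuous_on UNIV (\<lambda>h::real^'n. \<chi> k. if k = i then - h $ k else h $ k)"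
  proof (rule continuous_on_vec_lambda)
    show "continuous_on UNIV (\<lambda>h::real^'n. if k = i then - h $ k else h $ k)" for k
      by (cases "k = i") (simp_all add: continuous_on_component continuous_on_minus)
  qed
  show "norm (\<chi> k. if k = i then - h $ k else h $ k) = norm h" for h :: "real^'n"
    by (auto simp: norm_vec_def L2_set_def intro!: sum.cong)
qed

lemma ball_average_swap_coordinates:
  fixes f :: "real^'n \<Rightarrow> real"
  assumes "continuous_on (cball 0 e) f"
  shows "ball_average (\<lambda>h. f (\<chi> k. h $ Transposition.transpose i j k)) 0 e = ball_average f 0 e"
proof (rule ball_average_isometry[OF assms _ lborel_distr_swap_coordinates])
  show "continuous_on UNIV (\<lambda>h::real^'n. \<chi> k. h $ Transposition.transpose i j k)"
    by (intro continuous_intros)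
  fix h :: "real^'n"
  have "(\<Sum>k\<in>UNIV. (\<lambda>k. (h $ k)\<^sup>2) (Transposition.transpose i j k)) = (\<Sum>k\<in>UNIV. (h $ k)\<^sup>2)"
    by (subst sum.reindex_bij_betw[of _ UNIV UNIV]) simp_all
  then show "norm (\<chi> k. h $ Transposition.transpose i j k) = norm h"
    by (simp add: norm_vec_def L2_set_def)
qed

section \<open>Second moments of the unit ball\<close>

lemma ball_average_coordinate: "ball_average (\<lambda>h::real^'n. h $ i) 0 e = 0"
proof -
  have "continuous_on (cball 0 e) (\<lambda>h::real^'n. h $ i)"
    by (intro continuous_intros)
  from ball_average_flip_coordinate[OF this, of i] ball_average_cmult[of "-1" "\<lambda>h. h $ i" 0 e]
  show ?thesis by simp
qed

lemma ball_average_mixed_coordinates: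
  assumes "i \<noteq> j"
  shows "ball_average (\<lambda>h::real^'n. h $ i * h $ j) 0 e = 0"
proof -
  have "continuous_on (cball 0 e) (\<lambda>h::real^'n. h $ i * h $ j)"
    by (intro continuous_intros)
  from ball_average_flip_coordinate[OF this, of i] ball_average_cmult[of "-1" "\<lambda>h. h $ i * h $ j" 0 e]
  show ?thesis using assms by simp
qed

lemma ball_average_square_coordinate:
  "ball_average (\<lambda>h::real^'n. (h $ i)\<^sup>2) 0 e = ball_average (\<lambda>h::real^'n. (h $ j)\<^sup>2) 0 e"
proof -
  have "continuous_on (cball 0 e) (\<lambda>h::real^'n. (h $ j)\<^sup>2)"
    by (intro continuous_intros)
  from ball_average_swap_coordinates[OF this, of i j]
  show ?thesis by simp
qed

text \<open>Let \<open>W r\<close> be the integral of \<open>|h|\<^sup>2\<close> over the ball of radius \<open>r\<close>, and \<open>V\<close> the volume of the unit ball.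
  Scaling gives \<open>W r = r\<^bsup>N+2\<^esup> W 1\<close>. On the shell \<open>s \<le> |h| < 1\<close> the integrand is between \<open>s\<^sup>2\<close> and \<open>1\<close>,
  and the shell has volume \<open>(1 - s\<^bsup>N\<^esup>) V\<close>. Dividing by \<open>1 - s\<close> and letting \<open>s\<close> tend to \<open>1\<close> gives
  \<open>(N + 2) W 1 = N V\<close>.\<close>

lemma ball_average_norm_squared:
  "ball_average (\<lambda>h::real^'n. (norm h)\<^sup>2) 0 1 = CARD('n) / (CARD('n) + 2)"
proof -
  let ?N = "CARD('n)"
  define W where "W = (\<lambda>r. \<integral>h. indicator (ball 0 r) h * (norm (h::real^'n))\<^sup>2 \<partial>lborel)"
  define V where "V = measure lebesgue (ball (0::real^'n) 1)"
  define m where "m = ball_average (\<lambda>h::real^'n. (norm h)\<^sup>2) 0 1"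
  have V: "V > 0"
    unfolding V_def by (rule ball_content_pos) simp
  have vol: "measure lebesgue (ball (0::real^'n) r) = r ^ ?N * V" if "r > 0" for r
    using content_ball_conv_unit_ball[of r "0::real^'n"] that by (simp add: V_def)
  have W: "W r = r ^ (?N + 2) * V * m" if r: "r > 0" for r
  proof -
    have "ball_average (\<lambda>h::real^'n. (norm h)\<^sup>2) 0 r = ball_average (\<lambda>h::real^'n. (norm (0 + r *\<^sub>R h))\<^sup>2) 0 1"
      using r by (intro ball_average_rescale continuous_intros)
    also have "\<dots> = r\<^sup>2 * m"
      by (simp add: power_mult_distrib ball_average_cmult m_def)
    finally have "W r / (r ^ ?N * V) = r\<^sup>2 * m"
      using vol[OF r] by (subst (asm) ball_average_eq_lborel(1)) (auto simp: W_def intro!: continuous_intros)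
    then show ?thesis
      using V r by (simp add: field_simps power_add power2_eq_square)
  qed
  have shell: "s\<^sup>2 * (V - s ^ ?N * V) \<le> W 1 - W s \<and> W 1 - W s \<le> V - s ^ ?N * V" if s: "0 < s" "s < 1" for s
  proof -
    have i1: "integrable lborel (\<lambda>h. indicator (ball 0 r) h * (norm (h::real^'n))\<^sup>2)" 
      and i2: "integrable lborel (\<lambda>h::real^'n. indicator (ball 0 r) h * (1::real))" for r
    proof -
      have "set_integrable lborel (cball 0 r) (\<lambda>h::real^'n. (norm h)\<^sup>2)"
        unfolding set_integrable_def by (intro borel_integrable_compact continuous_intros) auto
      from set_integrable_subset[OF this, of "ball 0 r"]
      show "integrable lborel (\<lambda>h. indicator (ball 0 r) h * (norm (h::real^'n))\<^sup>2)"
        by (auto simp: set_integrable_def)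
      show "integrable lborel (\<lambda>h::real^'n. indicator (ball 0 r) h * (1::real))"
        using emeasure_lborel_ball_finite[of "0::real^'n" r] by simp
    qed
    have d: "(\<integral>h. indicator (ball 0 1) h * 1 - indicator (ball 0 s) h * (1::real) \<partial>(lborel::(real^'n) measure))
        = V - s ^ ?N * V"
      using i2 vol[OF s(1)] by (subst Bochner_Integration.integral_diff) (auto simp: V_def)
    have dW: "(\<integral>h. indicator (ball 0 1) h * (norm h)\<^sup>2 - indicator (ball 0 s) h * (norm h)\<^sup>2 \<partial>(lborel::(real^'n) measure))
        = W 1 - W s"
      using i1 by (subst Bochner_Integration.integral_diff) (auto simp: W_def)
    have "(\<integral>h. s\<^sup>2 * (indicator (ball 0 1) h * 1 - indicator (ball 0 s) h * (1::real)) \<partial>(lborel::(real^'n) measure))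
        \<le> (\<integral>h. indicator (ball 0 1) h * (norm h)\<^sup>2 - indicator (ball 0 s) h * (norm h)\<^sup>2 \<partial>(lborel::(real^'n) measure))"
      using s i1 i2
      by (intro integral_mono Bochner_Integration.integrable_diff integrable_mult_right)
         (auto simp: indicator_def intro!: power_mono)
    moreover have "(\<integral>h. indicator (ball 0 1) h * (norm h)\<^sup>2 - indicator (ball 0 s) h * (norm h)\<^sup>2 \<partial>(lborel::(real^'n) measure))
        \<le> (\<integral>h. indicator (ball 0 1) h * 1 - indicator (ball 0 s) h * (1::real) \<partial>(lborel::(real^'n) measure))"
      using s i1 i2
      by (intro integral_mono Bochner_Integration.integrable_diff)
         (auto simp: indicator_def power_le_one_iff)
    ultimately show ?thesis
      unfolding dW integral_mult_right_zero d by simp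
  qed
  have lim: "((\<lambda>s. (1 - s ^ k) / (1 - s)) \<longlongrightarrow> real k) (at_left (1::real))" for k
  proof -
    have "((\<lambda>s::real. s ^ k) has_real_derivative real k * 1 ^ (k - 1)) (at 1 within {..<1})"
      by (auto intro!: derivative_eq_intros)
    then have "((\<lambda>s. (s ^ k - 1 ^ k) / (s - 1)) \<longlongrightarrow> real k) (at_left (1::real))"
      by (simp add: has_field_derivative_iff)
    moreover have "(s ^ k - 1 ^ k) / (s - 1) = (1 - s ^ k) / (1 - s)" for s :: real
      by (metis minus_diff_eq minus_divide_divide power_one)
    ultimately show ?thesis
      by simp
  qed
  have ev: "eventually (\<lambda>s::real. 0 < s \<and> s < 1) (at_left 1)"
    using eventually_at_left[of 0 "1::real"] by (auto intro!: exI[of _ 0])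
  have lo: "real ?N \<le> m * real (?N + 2)"
  proof (rule tendsto_le[of "at_left (1::real)"])
    show "((\<lambda>s. s\<^sup>2 * ((1 - s ^ ?N) / (1 - s))) \<longlongrightarrow> real ?N) (at_left (1::real))"
      using tendsto_mult[OF tendsto_power[OF tendsto_ident_at[of "1::real" "{..<1}"], of 2] lim] by simp
    show "((\<lambda>s. m * ((1 - s ^ (?N + 2)) / (1 - s))) \<longlongrightarrow> m * real (?N + 2)) (at_left (1::real))"
      by (intro tendsto_mult tendsto_const lim)
    show "eventually (\<lambda>s. s\<^sup>2 * ((1 - s ^ ?N) / (1 - s)) \<le> m * ((1 - s ^ (?N + 2)) / (1 - s))) (at_left 1)"
      using ev
    proof eventually_elim
      case (elim s)
      have "V * (s\<^sup>2 * (1 - s ^ ?N)) \<le> V * (m * (1 - s ^ (?N + 2)))"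
        using shell[of s] W[of s] W[of 1] elim by (simp add: algebra_simps)
      then have "s\<^sup>2 * (1 - s ^ ?N) \<le> m * (1 - s ^ (?N + 2))"
        using V by (simp only: mult_le_cancel_left_pos)
      then show ?case
        using elim by (simp only: times_divide_eq_right) (rule divide_right_mono, simp_all)
    qed
  qed simp
  have hi: "m * real (?N + 2) \<le> real ?N"
  proof (rule tendsto_le[of "at_left (1::real)"])
    show "((\<lambda>s. m * ((1 - s ^ (?N + 2)) / (1 - s))) \<longlongrightarrow> m * real (?N + 2)) (at_left (1::real))"
      by (intro tendsto_mult tendsto_const lim)
    show "((\<lambda>s. (1 - s ^ ?N) / (1 - s)) \<longlongrightarrow> real ?N) (at_left (1::real))"
      by (rule lim)
    show "eventually (\<lambda>s. m * ((1 - s ^ (?N + 2)) / (1 - s)) \<le> (1 - s ^ ?N) / (1 - s)) (at_left 1)"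
      using ev
    proof eventually_elim
      case (elim s)
      have "V * (m * (1 - s ^ (?N + 2))) \<le> V * (1 - s ^ ?N)"
        using shell[of s] W[of s] W[of 1] elim by (simp add: algebra_simps)
      then have "m * (1 - s ^ (?N + 2)) \<le> 1 - s ^ ?N"
        using V by (simp only: mult_le_cancel_left_pos)
      then show ?case
        using elim by (simp only: times_divide_eq_right) (rule divide_right_mono, simp_all)
    qed
  qed simp
  from lo hi show ?thesis
    by (simp add: m_def[symmetric] field_simps)
qed

lemma ball_average_linear: "ball_average (\<lambda>h::real^'n. h \<bullet> g) 0 e = 0"
proof -
  have "ball_average (\<lambda>h::real^'n. h \<bullet> g) 0 e = ball_average (\<lambda>h. \<Sum>i\<in>UNIV. g $ i * h $ i) 0 e"
    by (simp add: inner_vec_def mult.commute)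
  also have "\<dots> = (\<Sum>i\<in>UNIV. ball_average (\<lambda>h. g $ i * h $ i) 0 e)"
    by (intro ball_average_sum continuous_intros) auto
  finally show ?thesis
    by (simp add: ball_average_cmult ball_average_coordinate)
qed

lemma ball_average_quadratic_form:
  "ball_average (\<lambda>h::real^'n. h \<bullet> (H *v h)) 0 1 = trace H / (CARD('n) + 2)"
proof -
  let ?m = "\<lambda>i j. ball_average (\<lambda>h::real^'n. h $ i * h $ j) 0 1"
  have diag: "?m i i = 1 / (CARD('n) + 2)" for i
  proof -
    have "ball_average (\<lambda>h::real^'n. (norm h)\<^sup>2) 0 1 = ball_average (\<lambda>h::real^'n. \<Sum>k\<in>UNIV. (h $ k)\<^sup>2) 0 1"
      unfolding power2_norm_eq_inner by (simp add: inner_vec_def power2_eq_square)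
    also have "\<dots> = (\<Sum>k\<in>(UNIV::'n set). ball_average (\<lambda>h::real^'n. (h $ k)\<^sup>2) 0 1)"
      by (intro ball_average_sum continuous_intros) auto
    also have "\<dots> = (\<Sum>k\<in>(UNIV::'n set). ball_average (\<lambda>h::real^'n. (h $ i)\<^sup>2) 0 1)"
      by (intro sum.cong refl ball_average_square_coordinate)
    also have "\<dots> = CARD('n) * ?m i i"
      by (simp add: power2_eq_square)
    finally show ?thesis
      by (simp add: ball_average_norm_squared divide_eq_eq eq_divide_eq)
  qed
  have "ball_average (\<lambda>h::real^'n. h \<bullet> (H *v h)) 0 1
      = ball_average (\<lambda>h. \<Sum>i\<in>UNIV. \<Sum>j\<in>UNIV. H $ i $ j * (h $ i * h $ j)) 0 1"
    by (simp add: inner_vec_def matrix_vector_mult_def sum_distrib_left mult.left_commute)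
  also have "\<dots> = (\<Sum>i\<in>UNIV. ball_average (\<lambda>h. \<Sum>j\<in>UNIV. H $ i $ j * (h $ i * h $ j)) 0 1)"
    by (intro ball_average_sum continuous_intros) auto
  also have "\<dots> = (\<Sum>i\<in>UNIV. \<Sum>j\<in>UNIV. ball_average (\<lambda>h. H $ i $ j * (h $ i * h $ j)) 0 1)"
    by (intro sum.cong refl ball_average_sum continuous_intros) auto
  also have "\<dots> = (\<Sum>i\<in>UNIV. \<Sum>j\<in>UNIV. if j = i then H $ i $ i / (CARD('n) + 2) else 0)"
    by (intro sum.cong refl) (auto simp: ball_average_cmult diag ball_average_mixed_coordinates)
  also have "\<dots> = trace H / (CARD('n) + 2)"
    by (simp add: trace_def sum_divide_distrib)
  finally show ?thesis .
qed

section \<open>Second order Taylor expansion\<close>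

lemma gderiv_gradient:
  fixes f :: "real^'n \<Rightarrow> real"
  assumes "f differentiable (at x)"
  shows "GDERIV f x :> gradient f x"
proof -
  obtain f' where f': "(f has_derivative f') (at x)"
    using assms by (auto simp: differentiable_def)
  then have lin: "linear f'"
    by (rule has_derivative_linear)
  have "f' = (\<lambda>h. h \<bullet> adjoint f' 1)"
    using adjoint_works[OF lin, of _ 1] by auto
  then have D: "GDERIV f x :> adjoint f' 1"
    using f' by (simp add: gderiv_def)
  have "D = adjoint f' 1" if "GDERIV f x :> D" for D
  proof -
    have "(\<lambda>h. h \<bullet> D) = (\<lambda>h. h \<bullet> adjoint f' 1)"
      using that D unfolding gderiv_def by (rule has_derivative_unique)
    then have "h \<bullet> D = h \<bullet> adjoint f' 1" for h
      by meson
    then show ?thesis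
      using vector_eq_ldot by blast
  qed
  with D show ?thesis
    unfolding gradient_def by (rule theI)
qed

text \<open>The mean value theorem on the segment from \<open>x\<close> to \<open>x + h\<close>, applied to \<open>f\<close> minus its quadratic
  Taylor polynomial. The derivative of that difference in direction \<open>h\<close> is the error in the linear
  approximation of the gradient, paired with \<open>h\<close>. Differentiating along the segment produces the Hessian
  only through its quadratic form \<open>h \<bullet> (H *v h)\<close>.\<close>

lemma second_order_taylor:
  fixes f :: "real^'n \<Rightarrow> real"
  assumes S: "open S" "x \<in> S"
    and f: "\<And>y. y \<in> S \<Longrightarrow> f differentiable (at y)"
    and g: "gradient f differentiable (at x)" and d: "0 < d"
  obtains \<rho> where "0 < \<rho>"
    "\<And>h. norm h < \<rho> \<Longrightarrow>
      \<bar>f (x + h) - f x - h \<bullet> gradient f x - (h \<bullet> (hessian f x *v h)) / 2\<bar> \<le> d * (norm h)\<^sup>2"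
proof -
  let ?g = "gradient f x" and ?H = "hessian f x"
  obtain r where r: "0 < r" "ball x r \<subseteq> S"
    using S open_contains_ball by blast
  have "(gradient f has_derivative (\<lambda>h. ?H *v h)) (at x)"
    using g by (simp add: hessian_def jacobian_works)
  then obtain s where s: "0 < s"
    "\<And>y. norm (y - x) < s \<Longrightarrow> norm (gradient f y - ?g - ?H *v (y - x)) \<le> d * norm (y - x)"
    using d unfolding has_derivative_at_alt by blast
  show thesis
  proof (rule that[of "min r s"])
    show "0 < min r s" using r s by simp
    fix h :: "real^'n"
    assume h: "norm h < min r s"
    define F where "F = (\<lambda>t. f (x + t *\<^sub>R h) - t * (h \<bullet> ?g) - t\<^sup>2 / 2 * (h \<bullet> (?H *v h)))"
    have small: "norm (t *\<^sub>R h) \<le> norm h" if "0 \<le> t" "t \<le> 1" for t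
      using that by (simp add: mult_left_le_one_le)
    have F': "(F has_real_derivative h \<bullet> (gradient f (x + t *\<^sub>R h) - ?g - ?H *v (t *\<^sub>R h))) (at t)"
      if t: "0 \<le> t" "t \<le> 1" for t
    proof -
      have "x + t *\<^sub>R h \<in> S"
        using small[OF t] h r(2) by (auto simp: dist_norm)
      then have "(f has_derivative (\<lambda>k. k \<bullet> gradient f (x + t *\<^sub>R h))) (at (x + t *\<^sub>R h))"
        using f gderiv_gradient unfolding gderiv_def by blast
      moreover have "((\<lambda>t. x + t *\<^sub>R h) has_derivative (\<lambda>k. k *\<^sub>R h)) (at t)"
        by (auto intro!: derivative_eq_intros)
      ultimately have "((\<lambda>t. f (x + t *\<^sub>R h)) has_derivative (\<lambda>k. (k *\<^sub>R h) \<bullet> gradient f (x + t *\<^sub>R h))) (at t)"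
        by (rule has_derivative_compose[rotated])
      then have 1: "((\<lambda>t. f (x + t *\<^sub>R h)) has_real_derivative h \<bullet> gradient f (x + t *\<^sub>R h)) (at t)"
        by (rule has_derivative_imp_has_field_derivative) (simp add: mult.commute)
      have 2: "((\<lambda>t. t * c) has_real_derivative c) (at t)" for c :: real
        by (auto intro!: derivative_eq_intros)
      have 3: "((\<lambda>t. t\<^sup>2 / 2 * c) has_real_derivative t * c) (at t)" for c :: real
        by (auto intro!: derivative_eq_intros)
      have 4: "h \<bullet> gradient f (x + t *\<^sub>R h) - h \<bullet> ?g - t * (h \<bullet> (?H *v h))
          = h \<bullet> (gradient f (x + t *\<^sub>R h) - ?g - ?H *v (t *\<^sub>R h))"
        by (simp add: inner_diff_right matrix_vector_mult_scaleR)
      from DERIV_diff[OF DERIV_diff[OF 1 2[of "h \<bullet> ?g"]] 3[of "h \<bullet> (?H *v h)"]] show ?thesis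
        unfolding F_def 4 .
    qed
    obtain z where z: "0 < z" "z < 1"
      "F 1 - F 0 = h \<bullet> (gradient f (x + z *\<^sub>R h) - ?g - ?H *v (z *\<^sub>R h))"
      using MVT2[OF zero_less_one F'] by auto
    have "norm (gradient f (x + z *\<^sub>R h) - ?g - ?H *v (z *\<^sub>R h)) \<le> d * norm (z *\<^sub>R h)"
      using s(2)[of "x + z *\<^sub>R h"] small[of z] z h by simp
    also have "\<dots> \<le> d * norm h"
      using small[of z] z d by simp
    finally have "\<bar>F 1 - F 0\<bar> \<le> norm h * (d * norm h)"
      unfolding z(3) by (meson Cauchy_Schwarz_ineq2 mult_left_mono norm_ge_zero order_trans)
    then show "\<bar>f (x + h) - f x - h \<bullet> ?g - (h \<bullet> (?H *v h)) / 2\<bar> \<le> d * (norm h)\<^sup>2"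
      by (simp add: F_def power2_eq_square algebra_simps)
  qed
qed

text \<open>Stated for displacements \<open>e h\<close> with \<open>h\<close> in the unit ball, uniformly in \<open>h\<close>, because
  extrema and means over the ball of radius \<open>e\<close> need precisely this uniformity.\<close>

definition quadratic_expansion ::
  "(real^'n \<Rightarrow> real) \<Rightarrow> real^'n \<Rightarrow> real^'n \<Rightarrow> real^'n^'n \<Rightarrow> bool" where
  "quadratic_expansion f x g H \<longleftrightarrow>
     (\<forall>d>0. \<forall>\<^sub>F e in at_right 0. \<forall>h\<in>cball 0 1.
        \<bar>f (x + e *\<^sub>R h) - (f x + e * (h \<bullet> g) + e\<^sup>2 / 2 * (h \<bullet> (H *v h)))\<bar> \<le> d * e\<^sup>2)"

lemma eventually_at_right_0_less: "0 < c \<Longrightarrow> \<forall>\<^sub>F e in at_right (0::real). 0 < e \<and> e < c"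
  unfolding eventually_at_right_field by (auto intro!: exI[of _ c])

lemma C2_imp_quadratic_expansion:
  fixes f :: "real^'n \<Rightarrow> real"
  assumes S: "open S" "x \<in> S" and f: "C2_fun_on S f"
  shows "quadratic_expansion f x (gradient f x) (hessian f x)"
  unfolding quadratic_expansion_def
proof (intro allI impI)
  fix d :: real
  assume d: "0 < d"
  have f': "\<And>y. y \<in> S \<Longrightarrow> f differentiable (at y)" and g: "gradient f differentiable (at x)"
    using f S by (auto simp: C2_fun_on_def C1_fun_on_def)
  obtain \<rho> where \<rho>: "0 < \<rho>"
    "\<And>h. norm h < \<rho> \<Longrightarrow>
      \<bar>f (x + h) - f x - h \<bullet> gradient f x - (h \<bullet> (hessian f x *v h)) / 2\<bar> \<le> d * (norm h)\<^sup>2"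
    using second_order_taylor[OF S f' g d] by metis
  show "\<forall>\<^sub>F e in at_right 0. \<forall>h\<in>cball 0 1.
      \<bar>f (x + e *\<^sub>R h) - (f x + e * (h \<bullet> gradient f x) + e\<^sup>2 / 2 * (h \<bullet> (hessian f x *v h)))\<bar> \<le> d * e\<^sup>2"
    using eventually_at_right_0_less[OF \<rho>(1)]
  proof eventually_elim
    case (elim e)
    show ?case
    proof
      fix h :: "real^'n"
      assume "h \<in> cball 0 1"
      then have h: "norm h \<le> 1" by simp
      have *: "norm (e *\<^sub>R h) \<le> e"
        using elim h by simp
      then have "\<bar>f (x + e *\<^sub>R h) - (f x + e * (h \<bullet> gradient f x) + e\<^sup>2 / 2 * (h \<bullet> (hessian f x *v h)))\<bar>
          \<le> d * (norm (e *\<^sub>R h))\<^sup>2"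
        using \<rho>(2)[of "e *\<^sub>R h"] elim le_less_trans[OF *, of \<rho>]
        by (simp add: matrix_vector_mult_scaleR power2_eq_square algebra_simps)
      also have "\<dots> \<le> d * e\<^sup>2"
        using d * by (intro mult_left_mono power_mono) auto
      finally show "\<bar>f (x + e *\<^sub>R h) - (f x + e * (h \<bullet> gradient f x) + e\<^sup>2 / 2 * (h \<bullet> (hessian f x *v h)))\<bar>
          \<le> d * e\<^sup>2" .
    qed
  qed
qed

lemma matrix_vector_mult_uminus: "(- A) *v v = - (A *v v)" for A :: "real^'n^'m"
proof -
  have "(- A) *v v + A *v v = 0"
    by (simp flip: matrix_vector_mult_add_rdistrib)
  then show ?thesis
    by (simp add: eq_neg_iff_add_eq_0)
qed

lemma quadratic_expansion_uminus:
  assumes "quadratic_expansion f x g H"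
  shows "quadratic_expansion (\<lambda>y. - f y) x (- g) (- H)"
proof -
  have "- f (x + e *\<^sub>R h) - (- f x + e * (h \<bullet> - g) + e\<^sup>2 / 2 * (h \<bullet> (- H *v h)))
      = - (f (x + e *\<^sub>R h) - (f x + e * (h \<bullet> g) + e\<^sup>2 / 2 * (h \<bullet> (H *v h))))" for e h
    by (simp add: matrix_vector_mult_uminus)
  with assms show ?thesis
    unfolding quadratic_expansion_def by (simp only: abs_minus_cancel)
qed

section \<open>Extrema over small balls\<close>

lemma tendsto_real_leI:
  fixes f :: "'a \<Rightarrow> real"
  assumes "\<And>d. 0 < d \<Longrightarrow> \<forall>\<^sub>F t in F. \<bar>f t - l\<bar> \<le> d"
  shows "(f \<longlongrightarrow> l) F"
proof (rule tendstoI)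
  fix d :: real
  assume "0 < d"
  then have "\<forall>\<^sub>F t in F. \<bar>f t - l\<bar> \<le> d / 2" by (intro assms) simp
  then show "\<forall>\<^sub>F t in F. dist (f t) l < d"
    by eventually_elim (use \<open>0 < d\<close> in \<open>simp add: dist_real_def\<close>)
qed

text \<open>On the unit ball \<open>h \<bullet> g\<close> is maximal at \<open>n = sgn g\<close>, and it falls off quadratically:
  \<open>h \<bullet> g \<le> |g| (1 - d\<^sup>2/2)\<close> with \<open>d = |h - n|\<close>. The quadratic form can gain at most \<open>2 K d\<close> over its
  value at \<open>n\<close>. Of the total \<open>e\<^sup>2 K d - e |g| d\<^sup>2/2\<close>, completing the square leaves at most
  \<open>e\<^sup>3 K\<^sup>2 / (2 |g|)\<close>, which is of third order. This is where \<open>g \<noteq> 0\<close> matters.\<close>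

lemma quadratic_perturbation_max:
  fixes g h :: "real^'n"
  assumes g: "g \<noteq> 0" and h: "norm h \<le> 1" and e: "0 \<le> e"
    and K: "\<And>v. norm (H *v v) \<le> K * norm v"
  shows "e * (h \<bullet> g) + e\<^sup>2 / 2 * (h \<bullet> (H *v h))
    \<le> e * norm g + e\<^sup>2 / 2 * (sgn g \<bullet> (H *v sgn g)) + e ^ 3 * (K\<^sup>2 / (2 * norm g))"
proof -
  define n where "n = sgn g"
  define d where "d = norm (h - n)"
  have n: "norm n = 1" and gn: "g = norm g *\<^sub>R n"
    using g by (auto simp: n_def sgn_div_norm)
  have ng: "0 < norm g" using g by simp
  have Kb: "\<bar>v \<bullet> (H *v w)\<bar> \<le> norm v * (K * norm w)" for v w
    using Cauchy_Schwarz_ineq2[of v "H *v w"] K[of w] by (meson mult_left_mono norm_ge_zero order_trans)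
  have K0: "0 \<le> K" using order_trans[OF norm_ge_zero K[of n]] n by simp
  have "d\<^sup>2 = (norm h)\<^sup>2 + 1 - 2 * (h \<bullet> n)"
    using n unfolding d_def by (simp add: power2_norm_eq_inner inner_diff inner_commute norm_eq_1)
  moreover have "(norm h)\<^sup>2 \<le> 1"
    using h by (simp add: power_le_one_iff)
  ultimately have "h \<bullet> n \<le> 1 - d\<^sup>2 / 2"
    by linarith
  then have "norm g * (h \<bullet> n) \<le> norm g * (1 - d\<^sup>2 / 2)"
    using ng by simp
  then have lin: "h \<bullet> g \<le> norm g - norm g * d\<^sup>2 / 2"
    by (subst gn) (simp add: algebra_simps)
  have "h \<bullet> (H *v h) - n \<bullet> (H *v n) = (h - n) \<bullet> (H *v h) + n \<bullet> (H *v (h - n))"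
    by (simp add: matrix_vector_mult_diff_distrib inner_diff)
  also have "\<dots> \<le> d * (K * norm h) + norm n * (K * d)"
    using Kb[of "h - n" h] Kb[of n "h - n"] by (simp add: d_def)
  also have "\<dots> \<le> 2 * K * d"
    using h n K0 mult_left_le[of "norm h" "d * K"] by (simp add: d_def algebra_simps)
  finally have quad: "h \<bullet> (H *v h) \<le> n \<bullet> (H *v n) + 2 * K * d"
    by simp
  \<comment> \<open>Completing the square bounds the gain of the quadratic form by the loss of the linear one.\<close>
  have "0 \<le> (norm g * d - e * K)\<^sup>2 / (2 * norm g)"
    by simp
  also have "\<dots> = norm g * d\<^sup>2 / 2 - e * K * d + e\<^sup>2 * (K\<^sup>2 / (2 * norm g))"
    using ng by (simp add: power2_eq_square field_simps)
  finally have "e * (e * K * d) \<le> e * (norm g * d\<^sup>2 / 2 + e\<^sup>2 * (K\<^sup>2 / (2 * norm g)))"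
    using e by (intro mult_left_mono) simp_all
  moreover have "e * (h \<bullet> g) \<le> e * (norm g - norm g * d\<^sup>2 / 2)"
    using lin e by (rule mult_left_mono)
  moreover have "e\<^sup>2 / 2 * (h \<bullet> (H *v h)) \<le> e\<^sup>2 / 2 * (n \<bullet> (H *v n) + 2 * K * d)"
    using quad by (rule mult_left_mono) simp
  ultimately show ?thesis
    unfolding n_def[symmetric] by (simp add: algebra_simps power2_eq_square power3_eq_cube)
qed

text \<open>The lower bound is the value at \<open>x + e sgn g\<close>; the upper bound is
  \<open>quadratic_perturbation_max\<close>.\<close>

lemma SUP_cball_expansion:
  fixes f :: "real^'n \<Rightarrow> real"
  assumes f: "quadratic_expansion f x g H" and g: "g \<noteq> 0"
  shows "((\<lambda>e. ((SUP y\<in>cball x e. f y) - f x - e * norm g) / e\<^sup>2)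
    \<longlongrightarrow> (sgn g \<bullet> (H *v sgn g)) / 2) (at_right 0)"
proof (rule tendsto_real_leI)
  fix d :: real
  assume d: "0 < d"
  let ?n = "sgn g"
  obtain K where K: "\<And>v. norm (H *v v) \<le> norm v * K"
    using bounded_linear.bounded[OF matrix_vector_mul_bounded_linear[of H]] by blast
  define C where "C = K\<^sup>2 / (2 * norm g)"
  have C: "0 \<le> C" by (simp add: C_def)
  \<comment> \<open>For such radii the third order term \<open>e ^ 3 * C\<close> is at most \<open>d / 2 * e\<^sup>2\<close>; the Taylor remainder
    accounts for the other half of \<open>d\<close>.\<close>
  have small: "0 < d / 2 / (C + 1)" using d C by simp
  have "\<forall>\<^sub>F e in at_right 0. \<forall>h\<in>cball 0 1.
        \<bar>f (x + e *\<^sub>R h) - (f x + e * (h \<bullet> g) + e\<^sup>2 / 2 * (h \<bullet> (H *v h)))\<bar> \<le> d / 2 * e\<^sup>2"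
    using f half_gt_zero[OF d] unfolding quadratic_expansion_def by blast
  then show "\<forall>\<^sub>F e in at_right 0.
      \<bar>((SUP y\<in>cball x e. f y) - f x - e * norm g) / e\<^sup>2 - (?n \<bullet> (H *v ?n)) / 2\<bar> \<le> d"
    using eventually_at_right_0_less[OF small]
  proof eventually_elim
    case (elim e)
    then have e: "0 < e" and T: "\<And>h. norm h \<le> 1 \<Longrightarrow>
        \<bar>f (x + e *\<^sub>R h) - (f x + e * (h \<bullet> g) + e\<^sup>2 / 2 * (h \<bullet> (H *v h)))\<bar> \<le> d / 2 * e\<^sup>2"
      by auto
    define U where "U = f x + e * norm g + e\<^sup>2 / 2 * (?n \<bullet> (H *v ?n))"
    have "e * C \<le> e * (C + 1)" using e by simp
    also have "\<dots> \<le> d / 2"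
    proof -
      have "e * (C + 1) < d / 2"
        using elim C by (subst (asm) pos_less_divide_eq) simp_all
      then show ?thesis by simp
    qed
    finally have "e * C * e\<^sup>2 \<le> d / 2 * e\<^sup>2"
      by (rule mult_right_mono) simp
    then have eC: "e ^ 3 * C \<le> d / 2 * e\<^sup>2"
      by (simp add: power2_eq_square power3_eq_cube mult_ac)
    have up: "f y \<le> U + d * e\<^sup>2" if y: "y \<in> cball x e" for y
    proof -
      define h where "h = (y - x) /\<^sub>R e"
      have "norm h = norm (y - x) / e"
        using e by (simp add: h_def divide_inverse mult.commute)
      moreover have "norm (y - x) \<le> e"
        using y by (simp add: dist_norm norm_minus_commute)
      ultimately have h: "norm h \<le> 1"
        using e by simp
      have yh: "y = x + e *\<^sub>R h"
        using e by (simp add: h_def)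
      have "e * (h \<bullet> g) + e\<^sup>2 / 2 * (h \<bullet> (H *v h)) \<le> e * norm g + e\<^sup>2 / 2 * (?n \<bullet> (H *v ?n)) + e ^ 3 * C"
        unfolding C_def using K by (intro quadratic_perturbation_max g h) (use e in \<open>auto simp: mult.commute\<close>)
      then show ?thesis
        using T[OF h] eC unfolding yh U_def by linarith
    qed
    have "norm ?n \<le> 1" by (simp add: norm_sgn)
    moreover have "?n \<bullet> g = norm g"
      using g by (simp add: sgn_div_norm power2_norm_eq_inner[symmetric] power2_eq_square)
    ultimately have "\<bar>f (x + e *\<^sub>R ?n) - U\<bar> \<le> d / 2 * e\<^sup>2"
      using T[of ?n] unfolding U_def by simp
    moreover have "0 \<le> d * e\<^sup>2"
      using d by simp
    ultimately have lo: "U - d * e\<^sup>2 \<le> f (x + e *\<^sub>R ?n)"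
      by linarith
    have mem: "x + e *\<^sub>R ?n \<in> cball x e"
      using e by (simp add: dist_norm norm_sgn)
    have "(SUP y\<in>cball x e. f y) \<le> U + d * e\<^sup>2"
      using e up by (intro cSUP_least) auto
    moreover have "U - d * e\<^sup>2 \<le> (SUP y\<in>cball x e. f y)"
      using lo up mem by (intro cSUP_upper2[of _ _ "x + e *\<^sub>R ?n"] bdd_aboveI2[of _ _ "U + d * e\<^sup>2"])
    ultimately have "\<bar>(SUP y\<in>cball x e. f y) - U\<bar> \<le> d * e\<^sup>2"
      by simp
    then have "\<bar>(SUP y\<in>cball x e. f y) - U\<bar> / e\<^sup>2 \<le> d"
      using e by (simp add: divide_le_eq)
    moreover have "((SUP y\<in>cball x e. f y) - f x - e * norm g) / e\<^sup>2 - (?n \<bullet> (H *v ?n)) / 2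
        = ((SUP y\<in>cball x e. f y) - U) / e\<^sup>2"
      using e by (simp add: U_def field_simps)
    ultimately show ?case
      by (simp add: abs_divide)
  qed
qed

lemma INF_cball_expansion:
  fixes f :: "real^'n \<Rightarrow> real"
  assumes f: "quadratic_expansion f x g H" and g: "g \<noteq> 0"
  shows "((\<lambda>e. ((INF y\<in>cball x e. f y) - f x + e * norm g) / e\<^sup>2)
    \<longlongrightarrow> (sgn g \<bullet> (H *v sgn g)) / 2) (at_right 0)"
proof -
  have inf: "(INF y\<in>cball x e. f y) = - (SUP y\<in>cball x e. - f y)" for e
    by (simp add: Inf_real_def image_image)
  have "((\<lambda>e. - (((SUP y\<in>cball x e. - f y) - (- f x) - e * norm (- g)) / e\<^sup>2))
      \<longlongrightarrow> - ((sgn (- g) \<bullet> (- H *v sgn (- g))) / 2)) (at_right 0)"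
    using g by (intro tendsto_minus SUP_cball_expansion quadratic_expansion_uminus[OF f]) simp
  moreover have "- ((sgn (- g) \<bullet> (- H *v sgn (- g))) / 2) = (sgn g \<bullet> (H *v sgn g)) / 2"
    by (simp add: matrix_vector_mult_uminus sgn_minus linear_neg[OF matrix_vector_mul_linear])
  moreover have "- ((s - (- f x) - e * norm (- g)) / e\<^sup>2) = (- s - f x + e * norm g) / e\<^sup>2" for s e :: real
    by (simp only: minus_divide_left) simp
  ultimately show ?thesis
    by (simp only: inf)
qed

section \<open>Asymptotics of the means\<close>

text \<open>The linear term has mean zero, and the quadratic term has the mean given by the second moments of
  the unit ball.\<close>

lemma ball_average_expansion:
  fixes f :: "real^'n \<Rightarrow> real"
  assumes S: "open S" "x \<in> S" and cont: "continuous_on S f"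
    and f: "quadratic_expansion f x g H"
  shows "((\<lambda>e. (ball_average f x e - f x) / e\<^sup>2) \<longlongrightarrow> trace H / (2 * (CARD('n) + 2))) (at_right 0)"
proof (rule tendsto_real_leI)
  fix d :: real
  assume d: "0 < d"
  obtain r where r: "0 < r" "ball x r \<subseteq> S"
    using S open_contains_ball by blast
  have "\<forall>\<^sub>F e in at_right 0. \<forall>h\<in>cball 0 1.
        \<bar>f (x + e *\<^sub>R h) - (f x + e * (h \<bullet> g) + e\<^sup>2 / 2 * (h \<bullet> (H *v h)))\<bar> \<le> d * e\<^sup>2"
    using f d unfolding quadratic_expansion_def by blast
  then show "\<forall>\<^sub>F e in at_right 0. \<bar>(ball_average f x e - f x) / e\<^sup>2 - trace H / (2 * (CARD('n) + 2))\<bar> \<le> d"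
    using eventually_at_right_0_less[OF r(1)]
  proof eventually_elim
    case (elim e)
    let ?Q = "\<lambda>h. f x + e * (h \<bullet> g) + e\<^sup>2 / 2 * (h \<bullet> (H *v h))"
    have "cball x e \<subseteq> S"
      using elim r(2) by (intro order_trans[OF _ r(2)]) auto
    then have c: "continuous_on (cball x e) f"
      using cont continuous_on_subset by blast
    have cQ: "continuous_on (cball 0 1) (\<lambda>h. h \<bullet> g)" "continuous_on (cball 0 1) (\<lambda>h. h \<bullet> (H *v h))"
      by (intro continuous_intros matrix_vector_mult_linear_continuous_on)+
    have cf: "continuous_on (cball 0 1) (\<lambda>h. f (x + e *\<^sub>R h))"
    proof (rule continuous_on_compose2[OF c])
      show "(\<lambda>h. x + e *\<^sub>R h) ` cball 0 1 \<subseteq> cball x e"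
        using elim by (auto simp: dist_norm mult_le_cancel_left1)
    qed (intro continuous_intros)
    have "ball_average ?Q 0 1 = f x + e\<^sup>2 / 2 * (trace H / (CARD('n) + 2))"
      by (simp add: ball_average_add ball_average_cmult ball_average_const cQ
          ball_average_linear ball_average_quadratic_form continuous_on_add continuous_on_mult_left del: times_divide_eq_left)
    moreover have "\<bar>ball_average (\<lambda>h. f (x + e *\<^sub>R h)) 0 1 - ball_average ?Q 0 1\<bar> \<le> d * e\<^sup>2"
      using elim cf by (intro ball_average_close continuous_on_add continuous_on_mult_left cQ) auto
    ultimately have "\<bar>ball_average f x e - f x - e\<^sup>2 / 2 * (trace H / (CARD('n) + 2))\<bar> \<le> d * e\<^sup>2"
      using elim ball_average_rescale[of e x f] c by (simp add: algebra_simps)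
    then have "\<bar>ball_average f x e - f x - e\<^sup>2 / 2 * (trace H / (CARD('n) + 2))\<bar> / e\<^sup>2 \<le> d"
      using elim by (simp add: divide_le_eq)
    moreover have "(ball_average f x e - f x) / e\<^sup>2 - trace H / (2 * (CARD('n) + 2))
        = (ball_average f x e - f x - e\<^sup>2 / 2 * (trace H / (CARD('n) + 2))) / e\<^sup>2"
      using elim by (simp add: diff_divide_distrib)
    ultimately show ?case
      by (simp add: abs_divide)
  qed
qed

text \<open>The mean is multiplied by \<open>\<epsilon>\<close> where it is used, so an error \<open>o(e)\<close> is sufficient; it
  is the error in the linear approximation of \<open>f\<close> at \<open>x\<close>. All points involved lie within distance \<open>e (1 + |b|)\<close> of \<open>x\<close>.\<close>

lemma ball_average_symmetric_difference:
  fixes f :: "real^'n \<Rightarrow> real"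
  assumes S: "open S" "x \<in> S" and cont: "continuous_on S f" and f: "GDERIV f x :> g"
  shows "((\<lambda>e. ball_average (\<lambda>y. f (y + e *\<^sub>R b) - f (y - e *\<^sub>R b)) x e / e) \<longlongrightarrow> 2 * (b \<bullet> g)) (at_right 0)"
proof (rule tendsto_real_leI)
  fix d :: real
  assume d: "0 < d"
  define k where "k = 1 + norm b"
  have k: "0 < k" by (simp add: k_def add_pos_nonneg)
  obtain r where r: "0 < r" "ball x r \<subseteq> S"
    using S open_contains_ball by blast
  have "0 < d / (2 * k)" using d k by simp
  then obtain s where s: "0 < s"
    "\<And>y. norm (y - x) < s \<Longrightarrow> norm (f y - f x - (y - x) \<bullet> g) \<le> d / (2 * k) * norm (y - x)"
    using f unfolding gderiv_def has_derivative_at_alt by blast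
  have "0 < min r s / k" using r s k by simp
  from eventually_at_right_0_less[OF this]
  show "\<forall>\<^sub>F e in at_right 0.
      \<bar>ball_average (\<lambda>y. f (y + e *\<^sub>R b) - f (y - e *\<^sub>R b)) x e / e - 2 * (b \<bullet> g)\<bar> \<le> d"
  proof eventually_elim
    case (elim e)
    then have e: "0 < e" and ek: "e * k < min r s"
      using k by (simp_all add: pos_less_divide_eq del: min_less_iff_conj)
    let ?D = "\<lambda>y. f (y + e *\<^sub>R b) - f (y - e *\<^sub>R b)"
    have near: "norm (h + e *\<^sub>R c) \<le> e * k" if "norm h \<le> e" "norm c = norm b" for h c :: "real^'n"
      using norm_triangle_ineq[of h "e *\<^sub>R c"] that e by (simp add: k_def algebra_simps)
    have mem: "y + e *\<^sub>R c \<in> S" if "y \<in> cball x e" "norm c = norm b" for y c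
    proof -
      have "norm ((y - x) + e *\<^sub>R c) < r"
        using near[of "y - x" c] that ek by (simp add: dist_norm norm_minus_commute)
      then have "y + e *\<^sub>R c \<in> ball x r"
        by (simp add: dist_norm norm_minus_commute algebra_simps)
      then show ?thesis
        using r(2) by blast
    qed
    have c: "continuous_on (cball x e) ?D"
      by (intro continuous_on_diff continuous_on_compose2[OF cont] continuous_intros)
         (use mem[of _ b] mem[of _ "- b"] in auto)
    have est: "\<bar>f (x + h + e *\<^sub>R c) - (f x + (h + e *\<^sub>R c) \<bullet> g)\<bar> \<le> d / 2 * e"
      if "norm h \<le> e" "norm c = norm b" for h c
    proof -
      have "norm (f (x + h + e *\<^sub>R c) - f x - (h + e *\<^sub>R c) \<bullet> g) \<le> d / (2 * k) * norm (h + e *\<^sub>R c)"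
        using s(2)[of "x + h + e *\<^sub>R c"] near[OF that] ek by (simp add: algebra_simps)
      also have "\<dots> \<le> d / (2 * k) * (e * k)"
        using near[OF that] d k by (intro mult_left_mono) auto
      also have "\<dots> = d / 2 * e"
        using k by simp
      finally show ?thesis
        by (simp add: algebra_simps)
    qed
    have "\<bar>?D y - e * (2 * (b \<bullet> g))\<bar> \<le> d * e" if y: "y \<in> ball x e" for y
    proof -
      have n: "norm (y - x) \<le> e"
        using y by (simp add: dist_norm norm_minus_commute)
      let ?R = "\<lambda>c. f (x + (y - x) + e *\<^sub>R c) - (f x + ((y - x) + e *\<^sub>R c) \<bullet> g)"
      have "?D y - e * (2 * (b \<bullet> g)) = ?R b - ?R (- b)"
        by (simp add: inner_diff_left inner_add_left)
      moreover have "\<bar>?R b - ?R (- b)\<bar> \<le> \<bar>?R b\<bar> + \<bar>?R (- b)\<bar>"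
        by (rule abs_triangle_ineq4)
      moreover have "\<bar>?R b\<bar> \<le> d / 2 * e" "\<bar>?R (- b)\<bar> \<le> d / 2 * e"
        using est[OF n, of b] est[OF n, of "- b"] by simp_all
      ultimately show ?thesis by linarith
    qed
    then have "\<bar>ball_average ?D x e - ball_average (\<lambda>y. e * (2 * (b \<bullet> g))) x e\<bar> \<le> d * e"
      using e c by (intro ball_average_close) auto
    then have "\<bar>ball_average ?D x e - e * (2 * (b \<bullet> g))\<bar> / e \<le> d"
      using e by (simp add: ball_average_const divide_le_eq)
    moreover have "ball_average ?D x e / e - 2 * (b \<bullet> g) = (ball_average ?D x e - e * (2 * (b \<bullet> g))) / e"
      using e by (simp add: diff_divide_distrib)
    ultimately show ?case
      using e by (simp add: abs_divide)
  qed
qed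

section \<open>Limit of the expansion error\<close>

lemma alpha_beta_values:
  fixes \<alpha> \<beta> s N :: real
  assumes "\<alpha> + \<beta> = 1" "\<beta> \<noteq> 0" "\<alpha> / \<beta> = (s - 2) / (N + 2)" "0 < N + 2" "0 < N + s"
  shows "\<alpha> = (s - 2) / (N + s)" "\<beta> = (N + 2) / (N + s)"
proof -
  have "\<alpha> * (N + 2) = (s - 2) * \<beta>"
    using assms by (simp add: field_simps)
  moreover have "\<alpha> = 1 - \<beta>" using assms by simp
  ultimately have "\<beta> * (N + s) = N + 2"
    by (simp add: algebra_simps)
  then show b: "\<beta> = (N + 2) / (N + s)"
    using assms by (simp add: eq_divide_eq)
  show "\<alpha> = (s - 2) / (N + s)"
    using assms by (simp add: \<open>\<alpha> = 1 - \<beta>\<close> b field_simps)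
qed

text \<open>Since \<open>2 A + B = 1\<close>, the term \<open>\<phi>(x)\<close> can be distributed over the extrema and the mean, and each
  difference has a limit after division by \<open>\<epsilon>\<^sup>2\<close>. The identity \<open>M / (N + q) = a(x) |g|\<^bsup>q-p\<^esup> / (N + p)\<close>
  turns the \<open>q\<close>-weights into the coefficient \<open>a(x) |g|\<^bsup>q-p\<^esup>\<close> of the equation.\<close>

lemma expansion_error_limit:
  fixes \<phi> a :: "real^'n \<Rightarrow> real"
  assumes S: "open S" "x \<in> S" and \<phi>: "C2_fun_on S \<phi>" "gradient \<phi> x \<noteq> 0"
    and a: "0 \<le> a x" and pq: "1 < p" "p \<le> q"
    and \<alpha>p: "\<alpha>p + \<beta>p = 1" "\<beta>p \<noteq> 0" "\<alpha>p / \<beta>p = (p - 2) / (real CARD('n) + 2)"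
    and \<alpha>q: "\<alpha>q + \<beta>q = 1" "\<beta>q \<noteq> 0" "\<alpha>q / \<beta>q = (q - 2) / (real CARD('n) + 2)"
  shows "((\<lambda>e. expansion_error p q \<alpha>p \<beta>p \<alpha>q \<beta>q a \<phi> x e / e\<^sup>2)
    \<longlongrightarrow> - double_phase_op p q a \<phi> x / (2 * (real CARD('n) + p) * (1 + M_coeff p q a \<phi> x))) (at_right 0)"
proof -
  \<comment> \<open>\<open>A\<close>, \<open>B\<close> and \<open>C\<close> are the weights of the extrema, of the mean and of the symmetric difference.\<close>
  define N where "N = real CARD('n)"
  define M where "M = M_coeff p q a \<phi> x"
  define g where "g = gradient \<phi> x"
  define H where "H = hessian \<phi> x"
  define b where "b = gradient a x"
  define G where "G = norm g powr (q - p)"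
  define A where "A = (\<alpha>p + M * \<alpha>q) / (2 * (1 + M))"
  define B where "B = (\<beta>p + M * \<beta>q) / (1 + M)"
  define C where "C = G / (4 * (N + p) * (1 + M))"
  define I where "I = sgn g \<bullet> (H *v sgn g)"
  define T where "T = trace H"
  have N: "0 < N" and Np: "0 < N + p" and Nq: "0 < N + q"
    using pq by (auto simp: N_def)
  have M_eq: "M * (N + p) = a x * G * (N + q)"
    using Np by (simp add: M_def M_coeff_def N_def G_def g_def field_simps)
  have M0: "0 \<le> M"
    using a Np Nq by (simp add: M_def M_coeff_def N_def[symmetric])
  have g0: "g \<noteq> 0" using \<phi> by (simp add: g_def)
  have qe: "quadratic_expansion \<phi> x g H"
    unfolding g_def H_def by (rule C2_imp_quadratic_expansion[OF S \<phi>(1)])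
  have diff: "\<And>y. y \<in> S \<Longrightarrow> \<phi> differentiable (at y)"
    using \<phi>(1) by (auto simp: C2_fun_on_def C1_fun_on_def)
  have cont: "continuous_on S \<phi>"
    using diff by (meson continuous_at_imp_continuous_on differentiable_imp_continuous_within)
  have gd: "GDERIV \<phi> x :> g"
    unfolding g_def by (intro gderiv_gradient diff S)
  have inf: "inf_laplacian \<phi> x = I"
    by (simp add: inf_laplacian_def I_def g_def H_def sgn_div_norm matrix_vector_mult_scaleR
        inner_commute power2_eq_square divide_inverse)
  have AB: "2 * A + B = 1"
  proof -
    have "2 * A = (\<alpha>p + M * \<alpha>q) / (1 + M)"
    proof -
      have "2 * (v / (2 * w)) = v / w" for v w :: real
        by simp
      then show ?thesis
        unfolding A_def .
    qed
    then have "2 * A + B = ((\<alpha>p + \<beta>p) + M * (\<alpha>q + \<beta>q)) / (1 + M)"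
      by (simp add: B_def add_divide_distrib[symmetric] algebra_simps)
    then show ?thesis using M0 \<alpha>p \<alpha>q by simp
  qed
  let ?S = "\<lambda>e. SUP y\<in>cball x e. \<phi> y" and ?I = "\<lambda>e. INF y\<in>cball x e. \<phi> y"
  let ?D = "\<lambda>e. ball_average (\<lambda>y. \<phi> (y + e *\<^sub>R b) - \<phi> (y - e *\<^sub>R b)) x e"
  have lim: "((\<lambda>e. A * ((?S e - \<phi> x - e * norm g) / e\<^sup>2 + (?I e - \<phi> x + e * norm g) / e\<^sup>2)
        + B * ((ball_average \<phi> x e - \<phi> x) / e\<^sup>2) + C * (?D e / e))
      \<longlongrightarrow> A * (I / 2 + I / 2) + B * (T / (2 * (CARD('n) + 2))) + C * (2 * (b \<bullet> g))) (at_right 0)"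
    unfolding I_def T_def
    by (intro tendsto_add tendsto_mult tendsto_const SUP_cball_expansion INF_cball_expansion qe g0
        ball_average_expansion[OF S cont qe] ball_average_symmetric_difference[OF S cont gd])
  have ev: "\<forall>\<^sub>F e in at_right 0.
      A * ((?S e - \<phi> x - e * norm g) / e\<^sup>2 + (?I e - \<phi> x + e * norm g) / e\<^sup>2)
        + B * ((ball_average \<phi> x e - \<phi> x) / e\<^sup>2) + C * (?D e / e)
      = expansion_error p q \<alpha>p \<beta>p \<alpha>q \<beta>q a \<phi> x e / e\<^sup>2"
    using eventually_at_right_0_less[OF zero_less_one]
  proof eventually_elim
    case (elim e)
    have "expansion_error p q \<alpha>p \<beta>p \<alpha>q \<beta>q a \<phi> x e
        = - \<phi> x + A * (?S e + ?I e) + B * ball_average \<phi> x e + e * C * ?D e"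
      by (simp add: expansion_error_def A_def B_def C_def M_def G_def g_def b_def N_def)
    also have "\<dots> = - ((2 * A + B) * \<phi> x) + A * (?S e + ?I e) + B * ball_average \<phi> x e + e * C * ?D e"
      unfolding AB by simp
    also have "\<dots> = A * ((?S e - \<phi> x - e * norm g) + (?I e - \<phi> x + e * norm g))
        + B * (ball_average \<phi> x e - \<phi> x) + C * (e * ?D e)"
      by (simp add: algebra_simps)
    finally have err: "expansion_error p q \<alpha>p \<beta>p \<alpha>q \<beta>q a \<phi> x e
        = A * ((?S e - \<phi> x - e * norm g) + (?I e - \<phi> x + e * norm g))
          + B * (ball_average \<phi> x e - \<phi> x) + C * (e * ?D e)" .
    have "(A * (X + Y) + B * Z + C * (e * D)) / e\<^sup>2
        = A * (X / e\<^sup>2 + Y / e\<^sup>2) + B * (Z / e\<^sup>2) + C * (D / e)" for X Y Z D :: real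
      using elim by (simp add: add_divide_distrib distrib_left power2_eq_square)
    then show ?case
      unfolding err by (rule sym)
  qed
  have "A * (I / 2 + I / 2) + B * (T / (2 * (CARD('n) + 2))) + C * (2 * (b \<bullet> g))
      = - double_phase_op p q a \<phi> x / (2 * (N + p) * (1 + M))"
  proof -
    note vp = alpha_beta_values[OF \<alpha>p[folded N_def]] and vq = alpha_beta_values[OF \<alpha>q[folded N_def]]
    have q': "M / (N + q) = a x * G / (N + p)"
      using M_eq Np Nq by (simp add: field_simps)
    have A': "\<alpha>p + M * \<alpha>q = ((p - 2) + a x * G * (q - 2)) / (N + p)"
    proof -
      have "\<alpha>p + M * \<alpha>q = (p - 2) / (N + p) + (M / (N + q)) * (q - 2)"
        using N Np Nq by (simp add: vp vq)
      then show ?thesis by (simp add: q' add_divide_distrib)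
    qed
    have B': "\<beta>p + M * \<beta>q = (N + 2) * (1 + a x * G) / (N + p)"
    proof -
      have "\<beta>p + M * \<beta>q = (N + 2) / (N + p) + (M / (N + q)) * (N + 2)"
        using N Np Nq by (simp add: vp vq)
      then show ?thesis by (simp add: q' add_divide_distrib[symmetric] algebra_simps)
    qed
    have e1: "A * (I / 2 + I / 2) = ((p - 2) + a x * G * (q - 2)) * I / (2 * (N + p) * (1 + M))"
    proof -
      have "X / k / (2 * m) * (I / 2 + I / 2) = X * I / (2 * k * m)" for X k m :: real
        by (simp add: mult_ac)
      then show ?thesis
        unfolding A_def A' .
    qed
    have e2: "B * (T / (2 * (N + 2))) = (1 + a x * G) * T / (2 * (N + p) * (1 + M))"
    proof -
      have "n * X / k / m * (T / (2 * n)) = X * T / (2 * k * m)" if "n \<noteq> 0" for n X k m :: real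
        using that by (simp add: mult_ac)
      moreover have "N + 2 \<noteq> 0"
        using N by simp
      ultimately show ?thesis
        unfolding B_def B' .
    qed
    have e3: "C * (2 * (b \<bullet> g)) = G * (b \<bullet> g) / (2 * (N + p) * (1 + M))"
    proof -
      have "G / (4 * k * m) * (2 * X) = G * X / (2 * k * m)" for k m X :: real
        by simp
      then show ?thesis
        unfolding C_def .
    qed
    have "- double_phase_op p q a \<phi> x = ((p - 2) + a x * G * (q - 2)) * I + (1 + a x * G) * T + G * (b \<bullet> g)"
      by (simp add: double_phase_op_def inf laplacian_def T_def H_def G_def g_def b_def algebra_simps)
    moreover have "real (2 * (CARD('n) + 2)) = 2 * (N + 2)"
      by (simp add: N_def)
    ultimately show ?thesis
      using e1 e2 e3 by (simp only: add_divide_distrib)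
  qed
  with Lim_transform_eventually[OF lim ev] show ?thesis
    by (simp add: N_def M_def)
qed

section \<open>From the limit to the viscosity inequalities\<close>

text \<open>If \<open>L \<le> 0\<close>, the remainder \<open>r e = e\<^sup>2 L - E e\<close> is of order \<open>o(e\<^sup>2)\<close> and makes the sum exactly
  \<open>e\<^sup>2 L\<close>. Conversely, the inequality passes to the limit after division by \<open>e\<^sup>2\<close>.\<close>

lemma o_square_sign_le:
  fixes E :: "real \<Rightarrow> real"
  assumes E: "((\<lambda>e. E e / e\<^sup>2) \<longlongrightarrow> L) (at_right 0)"
  shows "(\<exists>r. ((\<lambda>e. r e / e\<^sup>2) \<longlongrightarrow> 0) (at_right 0) \<and> (\<forall>\<^sub>F e in at_right 0. E e + r e \<le> 0)) \<longleftrightarrow> L \<le> 0"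
proof
  assume "\<exists>r. ((\<lambda>e. r e / e\<^sup>2) \<longlongrightarrow> 0) (at_right 0) \<and> (\<forall>\<^sub>F e in at_right 0. E e + r e \<le> 0)"
  then obtain r where r: "((\<lambda>e. r e / e\<^sup>2) \<longlongrightarrow> 0) (at_right 0)" "\<forall>\<^sub>F e in at_right 0. E e + r e \<le> 0"
    by blast
  have "((\<lambda>e. E e / e\<^sup>2 + r e / e\<^sup>2) \<longlongrightarrow> L + 0) (at_right 0)"
    by (intro tendsto_add E r)
  moreover have "\<forall>\<^sub>F e in at_right 0. E e / e\<^sup>2 + r e / e\<^sup>2 \<le> 0"
    using r(2) by eventually_elim (simp add: add_divide_distrib[symmetric] divide_nonpos_nonneg)
  ultimately show "L \<le> 0"
    using tendsto_upperbound[of "\<lambda>e. E e / e\<^sup>2 + r e / e\<^sup>2" "L + 0" "at_right 0" 0] by simp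
next
  assume L: "L \<le> 0"
  define r where "r = (\<lambda>e. e\<^sup>2 * L - E e)"
  have "((\<lambda>e. L - E e / e\<^sup>2) \<longlongrightarrow> L - L) (at_right 0)"
    by (intro tendsto_intros E)
  moreover have "\<forall>\<^sub>F e in at_right 0. L - E e / e\<^sup>2 = r e / e\<^sup>2"
    using eventually_at_right_0_less[OF zero_less_one]
    by eventually_elim (simp add: r_def diff_divide_distrib)
  ultimately have "((\<lambda>e. r e / e\<^sup>2) \<longlongrightarrow> 0) (at_right 0)"
    using Lim_transform_eventually by fastforce
  moreover have "E e + r e \<le> 0" for e
    using L by (simp add: r_def mult_nonneg_nonpos)
  ultimately show "\<exists>r. ((\<lambda>e. r e / e\<^sup>2) \<longlongrightarrow> 0) (at_right 0) \<and> (\<forall>\<^sub>F e in at_right 0. E e + r e \<le> 0)"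
    by (intro exI[of _ r]) simp
qed

lemma o_square_sign_ge:
  fixes E :: "real \<Rightarrow> real"
  assumes E: "((\<lambda>e. E e / e\<^sup>2) \<longlongrightarrow> L) (at_right 0)"
  shows "(\<exists>r. ((\<lambda>e. r e / e\<^sup>2) \<longlongrightarrow> 0) (at_right 0) \<and> (\<forall>\<^sub>F e in at_right 0. E e + r e \<ge> 0)) \<longleftrightarrow> L \<ge> 0"
proof -
  have "((\<lambda>e. - E e / e\<^sup>2) \<longlongrightarrow> - L) (at_right 0)"
    using tendsto_minus[OF E] by simp
  note neg = o_square_sign_le[OF this]
  have "(\<exists>r. ((\<lambda>e. r e / e\<^sup>2) \<longlongrightarrow> 0) (at_right 0) \<and> (\<forall>\<^sub>F e in at_right 0. E e + r e \<ge> 0)) \<longleftrightarrow>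
      (\<exists>r. ((\<lambda>e. r e / e\<^sup>2) \<longlongrightarrow> 0) (at_right 0) \<and> (\<forall>\<^sub>F e in at_right 0. - E e + r e \<le> 0))"
    (is "(\<exists>r. ?P r) \<longleftrightarrow> (\<exists>r. ?Q r)")
  proof -
    have 1: "?P (\<lambda>e. - r e) \<longleftrightarrow> ?Q r" for r
      using tendsto_minus_cancel_left[of "\<lambda>e. r e / e\<^sup>2" 0 "at_right 0"] by (simp add: algebra_simps)
    show ?thesis
    proof
      assume "\<exists>r. ?P r"
      then obtain r where "?P r" by (elim exE)
      then have "?Q (\<lambda>e. - r e)"
        using 1[of "\<lambda>e. - r e"] by simp
      then show "\<exists>r. ?Q r"
        by (intro exI[of _ "\<lambda>e. - r e"])
    next
      assume "\<exists>r. ?Q r"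
      then obtain r where "?Q r" by (elim exE)
      then have "?P (\<lambda>e. - r e)"
        by (simp only: 1)
      then show "\<exists>r. ?P r"
        by (intro exI[of _ "\<lambda>e. - r e"])
    qed
  qed
  with neg show ?thesis by simp
qed

section \<open>Test functions touching at the point\<close>

lemma gradient_add_const: "gradient (\<lambda>y. \<phi> y + c) = gradient \<phi>"
proof -
  have "GDERIV (\<lambda>y. \<phi> y + c) x :> D \<longleftrightarrow> GDERIV \<phi> x :> D" for x D
    unfolding gderiv_def
    using has_derivative_add_const[of \<phi> _ "at x" c] has_derivative_add_const[of "\<lambda>y. \<phi> y + c" _ "at x" "- c"]
    by auto
  then show ?thesis
    by (auto simp: gradient_def)
qed

lemma C2_fun_on_add_const:
  assumes "C2_fun_on S \<phi>" shows "C2_fun_on S (\<lambda>y. \<phi> y + c)"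
  using assms
  by (auto simp: C2_fun_on_def C1_fun_on_def gradient_add_const hessian_def[abs_def] intro: differentiable_add)

lemma double_phase_op_add_const: "double_phase_op p q a (\<lambda>y. \<phi> y + c) x = double_phase_op p q a \<phi> x"
  by (simp add: double_phase_op_def inf_laplacian_def laplacian_def hessian_def gradient_add_const)

text \<open>A strict minimum of \<open>u - \<phi>\<close> at \<open>x\<close> remains one after \<open>\<phi>\<close> is raised by \<open>u x - \<phi> x\<close>, and then the
  two functions agree at \<open>x\<close>.\<close>

lemma viscosity_supersolution_iff_touching:
  assumes "lsc_on S u"
  shows "viscosity_supersolution S p q a u \<longleftrightarrow>
    (\<forall>x\<in>S. \<forall>\<phi>. C2_fun_on S \<phi> \<and> strict_min_at S (\<lambda>y. u y - \<phi> y) x \<and> u x = \<phi> x \<and> gradient \<phi> x \<noteq> 0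
        \<longrightarrow> double_phase_op p q a \<phi> x \<ge> 0)"
    (is "_ \<longleftrightarrow> ?touch")
proof
  assume touch: ?touch
  show "viscosity_supersolution S p q a u"
    unfolding viscosity_supersolution_def
  proof (intro conjI ballI allI impI; (elim conjE)?)
    show "lsc_on S u" by (rule assms)
    fix x \<phi>
    assume *: "x \<in> S" "C2_fun_on S \<phi>" "strict_min_at S (\<lambda>y. u y - \<phi> y) x" "gradient \<phi> x \<noteq> 0"
    let ?\<psi> = "\<lambda>y. \<phi> y + (u x - \<phi> x)"
    have 1: "C2_fun_on S ?\<psi>"
      using *(2) by (rule C2_fun_on_add_const)
    have 2: "strict_min_at S (\<lambda>y. u y - ?\<psi> y) x"
      using *(3) by (auto simp: strict_min_at_def)
    have 3: "u x = ?\<psi> x" "gradient ?\<psi> x \<noteq> 0"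
      using *(4) by (simp_all add: gradient_add_const)
    have "double_phase_op p q a ?\<psi> x \<ge> 0"
      by (rule touch[rule_format, OF *(1)]) (intro conjI 1 2 3)
    then show "double_phase_op p q a \<phi> x \<ge> 0"
      by (simp only: double_phase_op_add_const)
  qed
qed (auto simp: viscosity_supersolution_def)

lemma viscosity_subsolution_iff_touching:
  assumes "usc_on S u"
  shows "viscosity_subsolution S p q a u \<longleftrightarrow>
    (\<forall>x\<in>S. \<forall>\<phi>. C2_fun_on S \<phi> \<and> strict_max_at S (\<lambda>y. u y - \<phi> y) x \<and> u x = \<phi> x \<and> gradient \<phi> x \<noteq> 0
        \<longrightarrow> double_phase_op p q a \<phi> x \<le> 0)"
    (is "_ \<longleftrightarrow> ?touch")
proof
  assume touch: ?touch
  show "viscosity_subsolution S p q a u"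
    unfolding viscosity_subsolution_def
  proof (intro conjI ballI allI impI; (elim conjE)?)
    show "usc_on S u" by (rule assms)
    fix x \<phi>
    assume *: "x \<in> S" "C2_fun_on S \<phi>" "strict_max_at S (\<lambda>y. u y - \<phi> y) x" "gradient \<phi> x \<noteq> 0"
    let ?\<psi> = "\<lambda>y. \<phi> y + (u x - \<phi> x)"
    have 1: "C2_fun_on S ?\<psi>"
      using *(2) by (rule C2_fun_on_add_const)
    have 2: "strict_max_at S (\<lambda>y. u y - ?\<psi> y) x"
      using *(3) by (auto simp: strict_max_at_def)
    have 3: "u x = ?\<psi> x" "gradient ?\<psi> x \<noteq> 0"
      using *(4) by (simp_all add: gradient_add_const)
    have "double_phase_op p q a ?\<psi> x \<le> 0"
      by (rule touch[rule_format, OF *(1)]) (intro conjI 1 2 3)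
    then show "double_phase_op p q a \<phi> x \<le> 0"
      by (simp only: double_phase_op_add_const)
  qed
qed (auto simp: viscosity_subsolution_def)

section \<open>The characterization\<close>

lemma continuous_imp_lsc_usc:
  assumes "continuous_on S u"
  shows "lsc_on S u" "usc_on S u"
  using assms
  by (auto simp: lsc_on_def usc_on_def continuous_on_def intro: order_tendstoD)

theorem theorem1p1:
  fixes \<Omega> :: "(real^'n) set"
    and a u :: "real^'n \<Rightarrow> real"
    and p q \<alpha>p \<beta>p \<alpha>q \<beta>q :: real
  assumes "CARD('n) \<ge> 2"
    and "open \<Omega>" "connected \<Omega>" "\<Omega> \<noteq> {}" "bounded \<Omega>"
    and "1 < p" "p \<le> q"
    and "\<And>x. x \<in> \<Omega> \<Longrightarrow> 0 \<le> a x" "C1_fun_on \<Omega> a"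
    and "continuous_on \<Omega> u"
    and "\<alpha>p + \<beta>p = 1" "\<beta>p \<noteq> 0" "\<alpha>p / \<beta>p = (p - 2) / (real CARD('n) + 2)"
    and "\<alpha>q + \<beta>q = 1" "\<beta>q \<noteq> 0" "\<alpha>q / \<beta>q = (q - 2) / (real CARD('n) + 2)"
  shows "viscosity_solution \<Omega> p q a u \<longleftrightarrow>
    (\<forall>x\<in>\<Omega>. viscosity_expansion_at \<Omega> p q \<alpha>p \<beta>p \<alpha>q \<beta>q a u x)"
proof -
  let ?E = "expansion_error p q \<alpha>p \<beta>p \<alpha>q \<beta>q a"
  have lim: "((\<lambda>e. ?E \<phi> x e / e\<^sup>2)
      \<longlongrightarrow> - double_phase_op p q a \<phi> x / (2 * (real CARD('n) + p) * (1 + M_coeff p q a \<phi> x))) (at_right 0)"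
    if "x \<in> \<Omega>" "C2_fun_on \<Omega> \<phi>" "gradient \<phi> x \<noteq> 0" for x \<phi>
    using that assms by (intro expansion_error_limit[of \<Omega>]) auto
  have pos: "0 < 2 * (real CARD('n) + p) * (1 + M_coeff p q a \<phi> x)" if "x \<in> \<Omega>" for x \<phi>
  proof -
    have "0 \<le> M_coeff p q a \<phi> x"
      using assms(6,7,8) that by (simp add: M_coeff_def)
    then show ?thesis
      using assms(6) by (intro mult_pos_pos) auto
  qed
  have super: "(\<exists>r. ((\<lambda>e. r e / e\<^sup>2) \<longlongrightarrow> 0) (at_right 0) \<and> (\<forall>\<^sub>F e in at_right 0. ?E \<phi> x e + r e \<le> 0))
      \<longleftrightarrow> double_phase_op p q a \<phi> x \<ge> 0"
    if "x \<in> \<Omega>" "C2_fun_on \<Omega> \<phi>" "gradient \<phi> x \<noteq> 0" for x \<phi>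
    unfolding o_square_sign_le[OF lim[OF that]] using pos[OF that(1), of \<phi>]
    by (subst divide_le_0_iff) auto
  have sub: "(\<exists>r. ((\<lambda>e. r e / e\<^sup>2) \<longlongrightarrow> 0) (at_right 0) \<and> (\<forall>\<^sub>F e in at_right 0. ?E \<phi> x e + r e \<ge> 0))
      \<longleftrightarrow> double_phase_op p q a \<phi> x \<le> 0"
    if "x \<in> \<Omega>" "C2_fun_on \<Omega> \<phi>" "gradient \<phi> x \<noteq> 0" for x \<phi>
    unfolding o_square_sign_ge[OF lim[OF that]] using pos[OF that(1), of \<phi>]
    by (subst zero_le_divide_iff) auto
  show ?thesis
    unfolding viscosity_solution_def viscosity_expansion_at_def
      viscosity_supersolution_iff_touching[OF continuous_imp_lsc_usc(1)[OF assms(10)]]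
      viscosity_subsolution_iff_touching[OF continuous_imp_lsc_usc(2)[OF assms(10)]]
    using super sub by (simp add: ball_conj_distrib cong: conj_cong imp_cong)
qed

end
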